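(* Consider the PWA Lur'e system $$\dot x(t)=A_ix(t)+a_i+Bp_\epsilon(t),\quad q(t)=C_ix(t)+c_i+Dp_\epsilon(t)\ \text{ for } x(t)\in X_i,\qquad p_\epsilon(t)=-\epsilon(q(t)),\qquad x(0)=x_0,$$ with state space $X\subseteq\mathbb{R}^n$, scalar signals $p_\epsilon,q$, and polyhedral partition $\{X_i\}_{i\in\mathcal I}$ of $X$, $\mathcal I=\{1,\dots,N\}$ (see context), and let $\epsilon:\mathbb{R}\to\mathbb{R}$ be Lipschitz continuous with Lipschitz constant $\eta>0$. With the matrices $\bar A_{ij},\bar B,\bar C_{ij},\bar D,\bar G_{ij},\bar E_{ijkl},\bar J_n,\bar I_1,\bar P_{ii}$ defined in the context, suppose there exist: symmetric matrices $P_i\in\mathbb{R}^{n\times n}$ ($i\in\mathcal I$) and $\bar P_{ij}\in\mathbb{R}^{(2n+1)\times(2n+1)}$ ($i\ne j$); symmetric matrices $U_{ij},R_{ij},W_{ij}\in\mathbb{R}^{p_{ij}\times p_{ij}}$ with nonnegative entries and zero diagonal ($i\neq j$), where $p_{ij}$ is the number of rows of $\bar G_{ij}$; vectors $L_{ijkl}\in\mathbb{R}^{(2n+1)\times 1}$; and positive scalars $\sigma_1,\sigma_2,\sigma_3$, such that (1) for every $i\in\mathcal I$: $P_i-\sigma_1I_n\succeq0$, $P_i-\sigma_2I_n\preceq0$, and $$\begin{bmatrix}A_i^TP_i+P_iA_i+C_i^TC_i+\sigma_3I_n & P_iB+C_i^TD\\ (P_iB+C_i^TD)^T & D^TD-\eta^{-2}\end{bmatrix}\preceq0;$$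 (2) for every $(i,j)\in\mathcal I\times\mathcal I$ with $i\ne j$: $\bar P_{ij}-\sigma_1\bar J_n-\bar G_{ij}^TU_{ij}\bar G_{ij}\succeq0$, $\bar P_{ij}-\sigma_2\bar J_n+\bar G_{ij}^TR_{ij}\bar G_{ij}\preceq0$, and $$\begin{bmatrix}\bar A_{ij}^T\bar P_{ij}+\bar P_{ij}\bar A_{ij}+\bar C_{ij}^T\bar C_{ij}+\sigma_3\bar J_n+\bar G_{ij}^TW_{ij}\bar G_{ij} & \bar P_{ij}\bar B+\bar C_{ij}^T\bar D\\ (\bar P_{ij}\bar B+\bar C_{ij}^T\bar D)^T & \bar D^T\bar D-\eta^{-2}\bar I_1\end{bmatrix}\preceq0;$$ (3) for all distinct pairs $(i,j),(k,l)\in\mathcal I\times\mathcal I$ with $X_{ij}\cap X_{kl}\neq\varnothing$: $$\bar P_{ij}=\bar P_{kl}+L_{ijkl}\bar E_{ijkl}+\bar E_{ijkl}^TL_{ijkl}^T.$$ Then the system is incrementally asymptotically stable.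
   Context: System data: $A_i\in\mathbb{R}^{n\times n}$, $a_i\in\mathbb{R}^n$, $B\in\mathbb{R}^{n\times1}$, $C_i\in\mathbb{R}^{1\times n}$, $c_i\in\mathbb{R}$, $D\in\mathbb{R}$. The regions $X_i=\{x\in X\mid G_ix+g_i\succeq0\}$ (componentwise inequality), $i\in\mathcal I=\{1,\dots,N\}$, are closed convex polyhedral sets with non-empty and pairwise disjoint interiors and $\bigcup_{i\in\mathcal I}X_i=X$. Trajectories: a trajectory from $x_0\in X$ is a locally absolutely continuous $x:[0,\infty)\to X$ with $x(0)=x_0$ such that for almost every $t$ there are $i\in\mathcal I$ with $x(t)\in X_i$ and real numbers $p_\epsilon(t),q(t)$ for which the system equations hold. It is a standing assumption that the system has a state transition map $\phi$, i.e. for each $x_0\in X$ there is a trajectory $x(t)=\phi(t,0,x_0)$, $t\ge0$, which is the trajectory from $x_0$. Incremental asymptotic stability: there is a function $\beta$ of class $\mathcal{KL}$ such that for all $x_0,\tilde x_0\in X$ and all $t\ge0$, $\|x(t)-\tilde x(t)\|\le\beta(\|x_0-\tilde x_0\|,t)$, where $x(t)=\phi(t,0,x_0)$, $\tilde x(t)=\phi(t,0,\tilde x_0)$ and $\|\cdot\|$ is the Euclidean norm. Class $\mathcal{KL}$: continuous $\beta:\mathbb{R}_+\times\mathbb{R}_+\to\mathbb{R}_+$ such that for each fixed $t\geq 0$, $\beta(\cdot,t)$ is continuous, strictly increasing and zero at $0$, and for each fixed $s$, $\beta(s,\cdot)$ is decreasing with $\lim_{t\to\infty}\beta(s,t)=0$.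 Augmented objects: write $\bar x=(x,\tilde x,1)^T$ (column concatenation) and $\bar X=X\times X\times\{1\}$; $X_{ij}=\{\bar x\in\bar X\mid x\in X_i,\ \tilde x\in X_j\}=\{\bar x\in\bar X\mid \bar G_{ij}\bar x\succeq0\}$, with $$\bar G_{ij}=\begin{bmatrix}G_i&0&g_i\\0&G_j&g_j\end{bmatrix},\quad \bar A_{ij}=\begin{bmatrix}A_i&0&a_i\\0&A_j&a_j\\0&0&0\end{bmatrix},\quad \bar B=\begin{bmatrix}B&0\\0&B\\0&0\end{bmatrix},$$ $$\bar C_{ij}=\begin{bmatrix}C_i&-C_j&c_i-c_j\end{bmatrix},\quad \bar D=\begin{bmatrix}D&-D\end{bmatrix},\quad \bar J_n=\begin{bmatrix}I_n&-I_n&0\\-I_n&I_n&0\\0&0&0\end{bmatrix},\quad \bar I_1=\begin{bmatrix}1&-1\\-1&1\end{bmatrix}.$$ For distinct pairs $(i,j),(k,l)$ with $X_{ij}\cap X_{kl}\ne\varnothing$, $\bar E_{ijkl}\in\mathbb{R}^{1\times(2n+1)}$ is a given row vector with $X_{ij}\cap X_{kl}\subseteq\{\bar x\in\bar X\mid\bar E_{ijkl}\bar x=0\}$. For diagonal pairs, $\bar P_{ii}$ denotes the matrix representing $(x-\tilde x)^TP_i(x-\tilde x)$ as a quadratic form in $\bar x$: $$\bar P_{ii}=\begin{bmatrix}P_i&-P_i&0\\-P_i&P_i&0\\0&0&0\end{bmatrix}.$$ For symmetric matrices, $M\succeq0$ ($M\preceq0$) means positive (negative) semidefinite. *)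

theory Defs
  imports "HOL-Analysis.Analysis"
begin

section \<open>Block matrices and semidefiniteness\<close>

text \<open>Juxtaposition (columns are indexed by a sum type) and stacking (rows are indexed by a
  sum type). Both bind weaker than the matrix operations, and \<open><|>\<close> binds stronger
  than \<open></>\<close>, so a block matrix can be written row by row.\<close>

definition beside :: "'a^'c^'r \<Rightarrow> 'a^'d^'r \<Rightarrow> 'a^('c + 'd)^'r"  (infixr "<|>" 60)
  where "A <|> B = (\<chi> r s. case s of Inl c \<Rightarrow> A $ r $ c | Inr d \<Rightarrow> B $ r $ d)"

definition above :: "'a^'c^'r \<Rightarrow> 'a^'c^'s \<Rightarrow> 'a^'c^('r + 's)"  (infixr "<'/>" 55)
  where "A </> B = (\<chi> r. case r of Inl i \<Rightarrow> A $ i | Inr j \<Rightarrow> B $ j)"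

definition vec_append :: "'a^'m \<Rightarrow> 'a^'n \<Rightarrow> 'a^('m + 'n)"  (infixr "<@>" 65)
  where "x <@> y = (\<chi> r. case r of Inl i \<Rightarrow> x $ i | Inr j \<Rightarrow> y $ j)"

text \<open>These are only applied to symmetric matrices.\<close>

definition pos_semidef :: "real^'k^'k \<Rightarrow> bool"
  where "pos_semidef M \<longleftrightarrow> (\<forall>v. 0 \<le> v \<bullet> (M *v v))"

definition neg_semidef :: "real^'k^'k \<Rightarrow> bool"
  where "neg_semidef M \<longleftrightarrow> (\<forall>v. v \<bullet> (M *v v) \<le> 0)"

text \<open>The number of inequalities describing a region depends on the region. A matrix with
  \<open>p\<close> rows, \<open>p\<close> a natural number, is therefore given by its rows
  \<open>H 0, \<dots>, H (p - 1)\<close>, and a \<open>p \<times> p\<close> matrix \<open>U\<close> by its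
  entries \<open>U r s\<close> with \<open>r, s < p\<close>; \<open>congruence p H U\<close> is
  $H^T U H$.\<close>

definition congruence :: "nat \<Rightarrow> (nat \<Rightarrow> real^'k) \<Rightarrow> (nat \<Rightarrow> nat \<Rightarrow> real) \<Rightarrow> real^'k^'k"
  where "congruence p H U = (\<chi> a b. \<Sum>r<p. \<Sum>s<p. H r $ a * U r s * H s $ b)"

definition sym_nonneg_zero_diag :: "nat \<Rightarrow> (nat \<Rightarrow> nat \<Rightarrow> real) \<Rightarrow> bool"
  where "sym_nonneg_zero_diag p U \<longleftrightarrow>
    (\<forall>r<p. \<forall>s<p. U r s = U s r \<and> 0 \<le> U r s) \<and> (\<forall>r<p. U r r = 0)"


section \<open>The system, its trajectories and incremental stability\<close>

text \<open>\<open>m i\<close> is the number of rows of $G_i$, and \<open>G i r\<close>, \<open>g i r\<close>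
  are the \<open>r\<close>-th rows of $G_i$ and $g_i$.\<close>

definition region ::
  "(real^'n) set \<Rightarrow> (nat \<Rightarrow> nat) \<Rightarrow> (nat \<Rightarrow> nat \<Rightarrow> real^'n) \<Rightarrow> (nat \<Rightarrow> nat \<Rightarrow> real) \<Rightarrow> nat \<Rightarrow> (real^'n) set"
  where "region X m G g i = {x \<in> X. \<forall>r < m i. 0 \<le> G i r \<bullet> x + g i r}"

definition polyhedral_partition ::
  "(real^'n) set \<Rightarrow> nat \<Rightarrow> (nat \<Rightarrow> nat) \<Rightarrow> (nat \<Rightarrow> nat \<Rightarrow> real^'n) \<Rightarrow> (nat \<Rightarrow> nat \<Rightarrow> real) \<Rightarrow> bool"
  where "polyhedral_partition X N m G g \<longleftrightarrow>
    1 \<le> N \<and>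
    (\<forall>i\<in>{1..N}. polyhedron (region X m G g i) \<and> interior (region X m G g i) \<noteq> {}) \<and>
    (\<forall>i\<in>{1..N}. \<forall>j\<in>{1..N}. i \<noteq> j \<longrightarrow>
       interior (region X m G g i) \<inter> interior (region X m G g j) = {}) \<and>
    (\<Union>i\<in>{1..N}. region X m G g i) = X"

definition abs_continuous_on_interval :: "real \<Rightarrow> real \<Rightarrow> (real \<Rightarrow> 'a::real_normed_vector) \<Rightarrow> bool"
  where "abs_continuous_on_interval a b f \<longleftrightarrow>
    (\<forall>e>0. \<exists>d>0. \<forall>(K::nat) u v.
       (\<forall>k<K. a \<le> u k \<and> u k \<le> v k \<and> v k \<le> b) \<and>
       (\<forall>k<K. \<forall>l<K. k \<noteq> l \<longrightarrow> {u k<..<v k} \<inter> {u l<..<v l} = {}) \<and>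
       (\<Sum>k<K. v k - u k) < d \<longrightarrow>
       (\<Sum>k<K. norm (f (v k) - f (u k))) < e)"

text \<open>The input matrix is a column and the output matrices are rows. A trajectory
  is a function on $[0,\infty)$; its values at negative times are irrelevant.\<close>

definition is_trajectory ::
  "(real^'n) set \<Rightarrow> nat \<Rightarrow> (nat \<Rightarrow> nat) \<Rightarrow> (nat \<Rightarrow> nat \<Rightarrow> real^'n) \<Rightarrow> (nat \<Rightarrow> nat \<Rightarrow> real)
    \<Rightarrow> (nat \<Rightarrow> real^'n^'n) \<Rightarrow> (nat \<Rightarrow> real^'n) \<Rightarrow> real^1^'n
    \<Rightarrow> (nat \<Rightarrow> real^'n^1) \<Rightarrow> (nat \<Rightarrow> real) \<Rightarrow> real \<Rightarrow> (real \<Rightarrow> real)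
    \<Rightarrow> real^'n \<Rightarrow> (real \<Rightarrow> real^'n) \<Rightarrow> bool"
  where "is_trajectory X N m G g A a B C c D \<epsilon> x0 x \<longleftrightarrow>
    (\<forall>t\<ge>0. x t \<in> X) \<and> x 0 = x0 \<and>
    (\<forall>T\<ge>0. abs_continuous_on_interval 0 T x) \<and>
    (AE t in lebesgue. 0 \<le> t \<longrightarrow>
      (\<exists>i\<in>{1..N}. x t \<in> region X m G g i \<and>
        (\<exists>p q. (x has_vector_derivative (A i *v x t + a i + B *v vec p)) (at t within {0..}) \<and>
          q = (C i *v x t) $ 1 + c i + D * p \<and>
          p = - \<epsilon> q)))"

text \<open>\<open>\<phi> t s x0\<close> is the state at time \<open>t\<close> when the state at time
  \<open>s\<close> is \<open>x0\<close>; only \<open>s = 0\<close> is used.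
  \<open>\<lambda>t. \<phi> t 0 x0\<close> is \<^emph>\<open>the\<close> trajectory from \<open>x0\<close>, hence the
  uniqueness clause.\<close>

definition is_state_transition_map ::
  "(real^'n) set \<Rightarrow> nat \<Rightarrow> (nat \<Rightarrow> nat) \<Rightarrow> (nat \<Rightarrow> nat \<Rightarrow> real^'n) \<Rightarrow> (nat \<Rightarrow> nat \<Rightarrow> real)
    \<Rightarrow> (nat \<Rightarrow> real^'n^'n) \<Rightarrow> (nat \<Rightarrow> real^'n) \<Rightarrow> real^1^'n
    \<Rightarrow> (nat \<Rightarrow> real^'n^1) \<Rightarrow> (nat \<Rightarrow> real) \<Rightarrow> real \<Rightarrow> (real \<Rightarrow> real)
    \<Rightarrow> (real \<Rightarrow> real \<Rightarrow> real^'n \<Rightarrow> real^'n) \<Rightarrow> bool"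
  where "is_state_transition_map X N m G g A a B C c D \<epsilon> \<phi> \<longleftrightarrow>
    (\<forall>x0\<in>X. is_trajectory X N m G g A a B C c D \<epsilon> x0 (\<lambda>t. \<phi> t 0 x0) \<and>
      (\<forall>y. is_trajectory X N m G g A a B C c D \<epsilon> x0 y \<longrightarrow> (\<forall>t\<ge>0. y t = \<phi> t 0 x0)))"

text \<open>Monotonicity in the second argument is not strict: \<open>\<beta> 0 t = 0\<close> for
  all \<open>t\<close>.\<close>

definition class_KL :: "(real \<Rightarrow> real \<Rightarrow> real) \<Rightarrow> bool"
  where "class_KL \<beta> \<longleftrightarrow>
    (\<forall>s\<ge>0. \<forall>t\<ge>0. 0 \<le> \<beta> s t) \<and>
    continuous_on ({0..} \<times> {0..}) (\<lambda>(s, t). \<beta> s t) \<and>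
    (\<forall>t\<ge>0. continuous_on {0..} (\<lambda>s. \<beta> s t) \<and> strict_mono_on {0..} (\<lambda>s. \<beta> s t) \<and> \<beta> 0 t = 0) \<and>
    (\<forall>s\<ge>0. antimono_on {0..} (\<lambda>t. \<beta> s t) \<and> ((\<lambda>t. \<beta> s t) \<longlongrightarrow> 0) at_top)"

definition incrementally_asymptotically_stable ::
  "(real^'n) set \<Rightarrow> (real \<Rightarrow> real \<Rightarrow> real^'n \<Rightarrow> real^'n) \<Rightarrow> bool"
  where "incrementally_asymptotically_stable X \<phi> \<longleftrightarrow>
    (\<exists>\<beta>. class_KL \<beta> \<and>
      (\<forall>x0\<in>X. \<forall>y0\<in>X. \<forall>t\<ge>0. norm (\<phi> t 0 x0 - \<phi> t 0 y0) \<le> \<beta> (norm (x0 - y0)) t))"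


section \<open>The augmented objects\<close>

definition aug :: "real^'n \<Rightarrow> real^'n \<Rightarrow> real^('n + 'n + 1)"
  where "aug x y = x <@> y <@> vec 1"

definition aug_region ::
  "(real^'n) set \<Rightarrow> (nat \<Rightarrow> nat) \<Rightarrow> (nat \<Rightarrow> nat \<Rightarrow> real^'n) \<Rightarrow> (nat \<Rightarrow> nat \<Rightarrow> real)
    \<Rightarrow> nat \<Rightarrow> nat \<Rightarrow> (real^('n + 'n + 1)) set"
  where "aug_region X m G g i j =
    {aug x y | x y. x \<in> region X m G g i \<and> y \<in> region X m G g j}"

text \<open>The rows of $\bar G_{ij}$; there are \<open>m i + m j\<close> of them.\<close>

definition G_aug ::
  "(nat \<Rightarrow> nat) \<Rightarrow> (nat \<Rightarrow> nat \<Rightarrow> real^'n) \<Rightarrow> (nat \<Rightarrow> nat \<Rightarrow> real) \<Rightarrow> nat \<Rightarrow> nat \<Rightarrow> nat \<Rightarrow> real^('n + 'n + 1)"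
  where "G_aug m G g i j r =
    (if r < m i then G i r <@> 0 <@> vec (g i r)
     else 0 <@> G j (r - m i) <@> vec (g j (r - m i)))"

definition A_aug :: "(nat \<Rightarrow> real^'n^'n) \<Rightarrow> (nat \<Rightarrow> real^'n) \<Rightarrow> nat \<Rightarrow> nat \<Rightarrow> real^('n + 'n + 1)^('n + 'n + 1)"
  where "A_aug A a i j =
     (A i <|> 0   <|> columnvector (a i) </>
      0   <|> A j <|> columnvector (a j) </>
      0   <|> 0   <|> 0)"

definition B_aug :: "real^1^'n \<Rightarrow> real^(1 + 1)^('n + 'n + 1)"
  where "B_aug B =
     (B <|> 0 </>
      0 <|> B </>
      0 <|> 0)"

definition C_aug :: "(nat \<Rightarrow> real^'n^1) \<Rightarrow> (nat \<Rightarrow> real) \<Rightarrow> nat \<Rightarrow> nat \<Rightarrow> real^('n + 'n + 1)^1"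
  where "C_aug C c i j = (C i <|> - C j <|> mat (c i - c j))"

definition D_aug :: "real \<Rightarrow> real^(1 + 1)^1"
  where "D_aug D = (mat D <|> mat (- D))"

definition P_diag :: "real^'n^'n \<Rightarrow> real^('n + 'n + 1)^('n + 'n + 1)"
  where "P_diag P =
     (P   <|> - P <|> 0 </>
      - P <|> P   <|> 0 </>
      0   <|> 0   <|> 0)"

definition P_aug ::
  "(nat \<Rightarrow> real^'n^'n) \<Rightarrow> (nat \<Rightarrow> nat \<Rightarrow> real^('n + 'n + 1)^('n + 'n + 1))
    \<Rightarrow> nat \<Rightarrow> nat \<Rightarrow> real^('n + 'n + 1)^('n + 'n + 1)"
  where "P_aug P Q i j = (if i = j then P_diag (P i) else Q i j)"

definition J_aug :: "real^('n::finite + 'n + 1)^('n + 'n + 1)"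
  where "J_aug =
     (mat 1   <|> - mat 1 <|> 0 </>
      - mat 1 <|> mat 1   <|> 0 </>
      0       <|> 0       <|> 0)"

definition I1_aug :: "real^(1 + 1)^(1 + 1)"
  where "I1_aug =
     (mat 1     <|> mat (- 1) </>
      mat (- 1) <|> mat 1)"

lemma sum_Plus_UNIV:
  fixes f :: "'a::finite + 'b::finite \<Rightarrow> 'c::comm_monoid_add"
  shows "(\<Sum>r\<in>UNIV. f r) = (\<Sum>i\<in>UNIV. f (Inl i)) + (\<Sum>j\<in>UNIV. f (Inr j))"
  using sum.Plus[of "UNIV :: 'a set" "UNIV :: 'b set" f] by (simp add: UNIV_Plus_UNIV)

lemma inner_vec_append:
  fixes x x' :: "real^'m" and y y' :: "real^'n"
  shows "(x <@> y) \<bullet> (x' <@> y') = x \<bullet> x' + y \<bullet> y'"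
  by (simp add: inner_vec_def vec_append_def sum_Plus_UNIV)

lemma above_mult_vec: "(A </> B) *v z = (A *v z) <@> (B *v z)"
  by (simp add: vec_eq_iff above_def vec_append_def matrix_vector_mult_def split: sum.split)

lemma beside_mult_vec:
  fixes A :: "real^'c^'r" and B :: "real^'d^'r"
  shows "(A <|> B) *v (x <@> y) = A *v x + B *v y"
  by (simp add: vec_eq_iff beside_def vec_append_def matrix_vector_mult_def sum_Plus_UNIV)

lemma aug_region_eq:
  "aug_region X m G g i j =
    {z \<in> {aug x y | x y. x \<in> X \<and> y \<in> X}. \<forall>r < m i + m j. 0 \<le> G_aug m G g i j r \<bullet> z}"
proof -
  have row: "G_aug m G g i j r \<bullet> aug x y =
      (if r < m i then G i r \<bullet> x + g i r else G j (r - m i) \<bullet> y + g j (r - m i))" for r x y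
    by (simp add: G_aug_def aug_def inner_vec_append) (simp add: inner_vec_def)
  have "(\<forall>r < m i + m j. 0 \<le> G_aug m G g i j r \<bullet> aug x y) \<longleftrightarrow>
      (\<forall>r < m i. 0 \<le> G i r \<bullet> x + g i r) \<and> (\<forall>r < m j. 0 \<le> G j r \<bullet> y + g j r)" for x y
    unfolding row
    by (auto split: if_splits) (metis add.commute add_diff_cancel_right' add_less_cancel_left not_add_less2)
  then show ?thesis
    unfolding aug_region_def region_def by blast
qed

lemma P_diag_quadratic_form:
  "aug x y \<bullet> (P_diag P *v aug x y) = (x - y) \<bullet> (P *v (x - y))"
proof -
  have "(- P) *v z = - (P *v z)" for z
    by (simp add: vec_eq_iff matrix_vector_mult_def sum_negf)
  then show ?thesis
    by (simp add: P_diag_def aug_def above_mult_vec beside_mult_vec inner_vec_append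
        matrix_vector_mult_diff_distrib inner_diff_left inner_diff_right)
qed

end

theory Submission
  imports Defs
begin

text \<open>
  The function $V(x, \tilde x) = \bar x^T \bar P_{ij} \bar x$ for $\bar x \in X_{ij}$ is well defined
  because the jump of the quadratic form vanishes where $\bar E_{ijkl} \bar x = 0$. The semidefinite
  constraints give $\sigma_1 |x - \tilde x|^2 \le V \le \sigma_2 |x - \tilde x|^2$ and, as the Lipschitz
  bound makes $|q - \tilde q|^2 - \eta^{-2} |p - \tilde p|^2$ nonnegative,
  $\dot V \le -\sigma_3 |x - \tilde x|^2 \le -(\sigma_3 / \sigma_2) V$ along pairs of trajectories.

  Two points need care because trajectories may switch regions infinitely often and slide along
  boundaries. First, $V$ along a pair of trajectories is absolutely continuous: an increment over an
  interval is a sum of increments of the finitely many quadratic forms over subintervals of it.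
  Second, at almost every time the right form to differentiate is the one of the region whose vector
  field is active: two forms agree at the times when both regions are occupied, so at accumulation
  points of this set their derivatives agree, and the remaining points of the set are countably many.
\<close>

section \<open>Absolutely continuous functions\<close>

text \<open>Numbering a finite index set by a bijection from \<open>{..<card I}\<close> transfers
  the definition from sequences of intervals to arbitrary finite families, so that the members of a
  tagged division can serve as indices themselves.\<close>

lemma abs_continuous_finite_sum:
  fixes f :: "real \<Rightarrow> 'a::real_normed_vector"
  assumes "abs_continuous_on_interval a b f" "0 < e"
  obtains d where "0 < d"
    "\<And>(I :: 'i set) u v. \<lbrakk>finite I; \<And>k. k \<in> I \<Longrightarrow> a \<le> u k \<and> u k \<le> v k \<and> v k \<le> b;
       disjoint_family_on (\<lambda>k. {u k<..<v k}) I; (\<Sum>k\<in>I. v k - u k) < d\<rbrakk> \<Longrightarrow>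
       (\<Sum>k\<in>I. norm (f (v k) - f (u k))) < e"
proof -
  obtain d where d: "0 < d"
    and *: "\<forall>(K::nat) u v. (\<forall>k<K. a \<le> u k \<and> u k \<le> v k \<and> v k \<le> b) \<and>
       (\<forall>k<K. \<forall>l<K. k \<noteq> l \<longrightarrow> {u k<..<v k} \<inter> {u l<..<v l} = {}) \<and>
       (\<Sum>k<K. v k - u k) < d \<longrightarrow> (\<Sum>k<K. norm (f (v k) - f (u k))) < e"
    using assms unfolding abs_continuous_on_interval_def by blast
  show thesis
  proof (rule that[OF d])
    fix I :: "'i set" and u v
    assume I: "finite I" "\<And>k. k \<in> I \<Longrightarrow> a \<le> u k \<and> u k \<le> v k \<and> v k \<le> b"
      "disjoint_family_on (\<lambda>k. {u k<..<v k}) I" "(\<Sum>k\<in>I. v k - u k) < d"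
    obtain h where h: "bij_betw h {..<card I} I"
      using ex_bij_betw_nat_finite[OF I(1)] by (auto simp: atLeast0LessThan)
    have hI: "h k \<in> I" if "k < card I" for k
      using h that by (auto simp: bij_betw_def)
    have hinj: "h k \<noteq> h l" if "k < card I" "l < card I" "k \<noteq> l" for k l
      using h that by (auto simp: bij_betw_def inj_on_def)
    have "(\<Sum>k<card I. norm (f (v (h k)) - f (u (h k)))) < e"
    proof (rule *[rule_format], intro conjI)
      show "\<forall>k<card I. a \<le> u (h k) \<and> u (h k) \<le> v (h k) \<and> v (h k) \<le> b"
        using I(2) hI by blast
      show "\<forall>k<card I. \<forall>l<card I. k \<noteq> l \<longrightarrow>
          {u (h k)<..<v (h k)} \<inter> {u (h l)<..<v (h l)} = {}"
        using I(3) hI hinj unfolding disjoint_family_on_def by blast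
      show "(\<Sum>k<card I. v (h k) - u (h k)) < d"
        using I(4) sum.reindex_bij_betw[OF h, of "\<lambda>k. v k - u k"] by simp
    qed
    then show "(\<Sum>k\<in>I. norm (f (v k) - f (u k))) < e"
      using sum.reindex_bij_betw[OF h, of "\<lambda>k. norm (f (v k) - f (u k))"] by simp
  qed
qed

text \<open>Sums of increments of \<open>h\<close> are at most \<open>K\<close> times those of
  \<open>f\<close> and \<open>g\<close> together, so it suffices to halve the tolerance. Bilinear
  products, Lipschitz functions and concatenated trajectories all obtain absolute continuity through
  this bound.\<close>

lemma abs_continuous_dominated:
  fixes f :: "real \<Rightarrow> 'a::real_normed_vector" and g :: "real \<Rightarrow> 'b::real_normed_vector"
    and h :: "real \<Rightarrow> 'c::real_normed_vector"
  assumes f: "abs_continuous_on_interval a b f" and g: "abs_continuous_on_interval a b g"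
    and h: "\<And>s t. \<lbrakk>s \<in> {a..b}; t \<in> {a..b}\<rbrakk> \<Longrightarrow>
      norm (h t - h s) \<le> K * (norm (f t - f s) + norm (g t - g s))"
  shows "abs_continuous_on_interval a b h"
  unfolding abs_continuous_on_interval_def
proof (intro allI impI)
  fix e :: real assume e: "0 < e"
  \<comment> \<open>\<open>K\<close> may be zero or negative; \<open>M\<close> is an upper bound of
    it by which the tolerance can be divided.\<close>
  define M where "M = max K 1"
  have M: "0 < M" "K \<le> M" by (auto simp: M_def)
  have e': "0 < e / (2 * M)" using e M by simp
  obtain d1 where d1: "0 < d1"
    "\<And>(I :: nat set) u v. \<lbrakk>finite I; \<And>k. k \<in> I \<Longrightarrow> a \<le> u k \<and> u k \<le> v k \<and> v k \<le> b;
       disjoint_family_on (\<lambda>k. {u k<..<v k}) I; (\<Sum>k\<in>I. v k - u k) < d1\<rbrakk> \<Longrightarrow>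
       (\<Sum>k\<in>I. norm (f (v k) - f (u k))) < e / (2 * M)"
    using abs_continuous_finite_sum[OF f e'] by blast
  obtain d2 where d2: "0 < d2"
    "\<And>(I :: nat set) u v. \<lbrakk>finite I; \<And>k. k \<in> I \<Longrightarrow> a \<le> u k \<and> u k \<le> v k \<and> v k \<le> b;
       disjoint_family_on (\<lambda>k. {u k<..<v k}) I; (\<Sum>k\<in>I. v k - u k) < d2\<rbrakk> \<Longrightarrow>
       (\<Sum>k\<in>I. norm (g (v k) - g (u k))) < e / (2 * M)"
    using abs_continuous_finite_sum[OF g e'] by blast
  show "\<exists>d>0. \<forall>(K::nat) u v.
       (\<forall>k<K. a \<le> u k \<and> u k \<le> v k \<and> v k \<le> b) \<and>
       (\<forall>k<K. \<forall>l<K. k \<noteq> l \<longrightarrow> {u k<..<v k} \<inter> {u l<..<v l} = {}) \<and>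
       (\<Sum>k<K. v k - u k) < d \<longrightarrow> (\<Sum>k<K. norm (h (v k) - h (u k))) < e"
  proof (intro exI[of _ "min d1 d2"] conjI allI impI, goal_cases)
    case 1 show ?case using d1 d2 by simp
  next
    case (2 n u v)
    have "(\<Sum>k<n. norm (h (v k) - h (u k)))
        \<le> (\<Sum>k<n. M * (norm (f (v k) - f (u k)) + norm (g (v k) - g (u k))))"
    proof (rule sum_mono)
      fix k assume "k \<in> {..<n}"
      then have "u k \<in> {a..b}" "v k \<in> {a..b}" using 2 by force+
      then have "norm (h (v k) - h (u k)) \<le> K * (norm (f (v k) - f (u k)) + norm (g (v k) - g (u k)))"
        by (rule h)
      also have "\<dots> \<le> M * (norm (f (v k) - f (u k)) + norm (g (v k) - g (u k)))"
        using M by (intro mult_right_mono) auto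
      finally show "norm (h (v k) - h (u k)) \<le> \<dots>" .
    qed
    also have "\<dots> = M * ((\<Sum>k<n. norm (f (v k) - f (u k))) + (\<Sum>k<n. norm (g (v k) - g (u k))))"
      by (simp add: sum_distrib_left sum.distrib distrib_left)
    also have "\<dots> < M * (e / (2 * M) + e / (2 * M))"
      using 2 M
      by (intro mult_strict_left_mono add_strict_mono d1(2) d2(2)) (auto simp: disjoint_family_on_def)
    also have "\<dots> = e" using M by simp
    finally show ?case .
  qed
qed

lemma abs_continuous_imp_continuous_on:
  fixes f :: "real \<Rightarrow> 'a::real_normed_vector"
  assumes "abs_continuous_on_interval a b f"
  shows "continuous_on {a..b} f"
  unfolding continuous_on_iff
proof (intro ballI allI impI)
  fix x e assume x: "x \<in> {a..b}" and e: "0 < (e::real)"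
  obtain d where d: "0 < d"
    "\<And>(I :: unit set) u v. \<lbrakk>finite I; \<And>k. k \<in> I \<Longrightarrow> a \<le> u k \<and> u k \<le> v k \<and> v k \<le> b;
       disjoint_family_on (\<lambda>k. {u k<..<v k}) I; (\<Sum>k\<in>I. v k - u k) < d\<rbrakk> \<Longrightarrow>
       (\<Sum>k\<in>I. norm (f (v k) - f (u k))) < e"
    using abs_continuous_finite_sum[OF assms e] by blast
  have "dist (f y) (f x) < e" if "y \<in> {a..b}" "dist y x < d" for y
    using d(2)[of "{()}" "\<lambda>_. min x y" "\<lambda>_. max x y"] that x
    by (cases "x \<le> y") (auto simp: disjoint_family_on_def dist_norm norm_minus_commute)
  then show "\<exists>d>0. \<forall>x'\<in>{a..b}. dist x' x < d \<longrightarrow> dist (f x') (f x) < e"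
    using d(1) by blast
qed

text \<open>Continuity on a compact interval bounds both factors, and the increment of the product
  splits into two terms, each containing the increment of one factor only.\<close>

lemma abs_continuous_bilinear:
  fixes f :: "real \<Rightarrow> 'a::real_normed_vector" and g :: "real \<Rightarrow> 'b::real_normed_vector"
  assumes p: "bounded_bilinear p"
    and f: "abs_continuous_on_interval a b f" and g: "abs_continuous_on_interval a b g"
  shows "abs_continuous_on_interval a b (\<lambda>t. p (f t) (g t))"
proof -
  interpret bounded_bilinear p by (rule p)
  obtain K where K: "0 \<le> K" "\<And>x y. norm (p x y) \<le> norm x * norm y * K"
    using nonneg_bounded by blast
  have "bounded (f ` {a..b})" "bounded (g ` {a..b})"
    using f g by (intro compact_imp_bounded compact_continuous_image abs_continuous_imp_continuous_on; simp)+
  then obtain M1 M2 where M: "\<And>t. t \<in> {a..b} \<Longrightarrow> norm (f t) \<le> M1" "\<And>t. t \<in> {a..b} \<Longrightarrow> norm (g t) \<le> M2"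
    unfolding bounded_iff by (metis image_eqI)
  show ?thesis
  proof (rule abs_continuous_dominated[OF f g, where K = "K * (max M1 M2)"])
    fix s t assume st: "s \<in> {a..b}" "t \<in> {a..b}"
    have "p (f t) (g t) - p (f s) (g s) = p (f t - f s) (g t) + p (f s) (g t - g s)"
      by (simp add: diff_left diff_right)
    also have "norm \<dots> \<le> norm (f t - f s) * norm (g t) * K + norm (f s) * norm (g t - g s) * K"
      using K(2) by (meson add_mono norm_triangle_le)
    also have "\<dots> \<le> norm (f t - f s) * max M1 M2 * K + max M1 M2 * norm (g t - g s) * K"
      using M[OF st(1)] M[OF st(2)] K(1)
      by (intro add_mono mult_right_mono mult_left_mono) auto
    finally show "norm (p (f t) (g t) - p (f s) (g s)) \<le> K * max M1 M2 * (norm (f t - f s) + norm (g t - g s))"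
      by (simp add: algebra_simps)
  qed
qed

text \<open>The identity is absolutely continuous with \<open>d = e\<close>, and the Lipschitz bound
  says that it dominates \<open>f\<close>. It is passed twice because domination is stated for two
  functions.\<close>

lemma lipschitz_imp_abs_continuous:
  fixes f :: "real \<Rightarrow> 'a::real_normed_vector"
  assumes "L-lipschitz_on {a..b} f"
  shows "abs_continuous_on_interval a b f"
proof -
  have id: "abs_continuous_on_interval a b (\<lambda>t. t)"
    unfolding abs_continuous_on_interval_def
  proof (intro allI impI)
    fix e :: real assume "0 < e"
    then show "\<exists>d>0. \<forall>(K::nat) u v.
       (\<forall>k<K. a \<le> u k \<and> u k \<le> v k \<and> v k \<le> b) \<and>
       (\<forall>k<K. \<forall>l<K. k \<noteq> l \<longrightarrow> {u k<..<v k} \<inter> {u l<..<v l} = {}) \<and>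
       (\<Sum>k<K. v k - u k) < d \<longrightarrow> (\<Sum>k<K. norm (v k - u k)) < e"
      by (intro exI[of _ e]) (auto simp: abs_of_nonneg cong: sum.cong_simp)
  qed
  show ?thesis
  proof (rule abs_continuous_dominated[OF id id, where K = L])
    fix s t assume st: "s \<in> {a..b}" "t \<in> {a..b}"
    have "norm (f t - f s) \<le> L * norm (t - s)"
      using lipschitz_onD[OF assms st(2,1)] by (simp add: dist_norm)
    also have "\<dots> \<le> L * (norm (t - s) + norm (t - s))"
      using lipschitz_on_nonneg[OF assms] by (intro mult_left_mono) auto
    finally show "norm (f t - f s) \<le> \<dots>" .
  qed
qed

text \<open>Every isolated point is cut out of \<open>S\<close> by some member of a countable basis,
  and distinct points need distinct members.\<close>

lemma countable_isolated_points:
  fixes S :: "'a::second_countable_topology set"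
  shows "countable {x \<in> S. \<not> x islimpt S}"
proof -
  obtain \<B> :: "'a set set" where \<B>: "countable \<B>" "topological_basis \<B>"
    using ex_countable_basis by blast
  have "\<exists>b\<in>\<B>. b \<inter> S = {x}" if x: "x \<in> S" "\<not> x islimpt S" for x
  proof -
    obtain T where T: "open T" "x \<in> T" "\<And>y. \<lbrakk>y \<in> S; y \<in> T\<rbrakk> \<Longrightarrow> y = x"
      using x(2) unfolding islimpt_def by blast
    obtain b where "b \<in> \<B>" "x \<in> b" "b \<subseteq> T"
      using topological_basisE[OF \<B>(2) T(1,2)] .
    then show ?thesis using T(3) x by blast
  qed
  then obtain f where f: "\<And>x. \<lbrakk>x \<in> S; \<not> x islimpt S\<rbrakk> \<Longrightarrow> f x \<in> \<B> \<and> f x \<inter> S = {x}"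
    by metis
  have "inj_on f {x \<in> S. \<not> x islimpt S}"
    by (rule inj_onI) (use f in \<open>metis (mono_tags, lifting) mem_Collect_eq singleton_inject\<close>)
  moreover have "f ` {x \<in> S. \<not> x islimpt S} \<subseteq> \<B>" using f by blast
  ultimately show ?thesis
    using \<B>(1) by (meson countable_image_inj_on countable_subset)
qed

text \<open>The gauge keeps the intervals tagged in \<open>Z\<close> inside an open set of small measure, so that
  absolute continuity makes their increments negligible.\<close>

lemma abs_continuous_nonincreasing:
  fixes v :: "real \<Rightarrow> real"
  assumes "a \<le> b" and ac: "abs_continuous_on_interval a b v" and Z: "negligible Z"
    and deriv: "\<And>t. \<lbrakk>t \<in> {a..b}; t \<notin> Z\<rbrakk> \<Longrightarrow> \<exists>d\<le>0. (v has_real_derivative d) (at t within {a..b})"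
  shows "v b \<le> v a"
proof (rule field_le_epsilon)
  fix e :: real assume e: "0 < e"
  \<comment> \<open>The slope allowed outside \<open>Z\<close>: it costs at most
    \<open>e / 2\<close> over the whole interval. The added 1 keeps the denominator positive when
    \<open>a = b\<close>.\<close>
  define e1 where "e1 = e / 2 / (b - a + 1)"
  have e1: "0 < e1" using e \<open>a \<le> b\<close> by (simp add: e1_def)
  obtain d where d: "0 < d"
    "\<And>(I :: (real \<times> real set) set) u w. \<lbrakk>finite I; \<And>k. k \<in> I \<Longrightarrow> a \<le> u k \<and> u k \<le> w k \<and> w k \<le> b;
       disjoint_family_on (\<lambda>k. {u k<..<w k}) I; (\<Sum>k\<in>I. w k - u k) < d\<rbrakk> \<Longrightarrow>
       (\<Sum>k\<in>I. norm (v (w k) - v (u k))) < e / 2"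
    using abs_continuous_finite_sum[OF ac half_gt_zero[OF e]] by blast
  \<comment> \<open>Outer regularity of Lebesgue measure makes \<open>T - Z\<close> small, and
    \<open>Z\<close> itself adds nothing to the measure.\<close>
  obtain T where T: "open T" "Z \<subseteq> T" "T \<in> lmeasurable" "measure lebesgue T < d"
  proof -
    have Zm: "Z \<in> sets lebesgue" "emeasure lebesgue Z = 0"
      using Z by (auto simp: negligible_iff_null_sets null_setsD1)
    obtain T where T: "open T" "Z \<subseteq> T" "T - Z \<in> lmeasurable" "emeasure lebesgue (T - Z) < ennreal d"
      using sets_lebesgue_outer_open[OF Zm(1) d(1)] by blast
    have TZ: "T = (T - Z) \<union> Z" using T(2) by blast
    have Zl: "Z \<in> lmeasurable" "measure lebesgue Z = 0"
      using Z by (auto simp: negligible_imp_measurable negligible_imp_measure0)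
    have Tl: "T \<in> lmeasurable" using T(3) Zl(1) TZ by (metis fmeasurable.Un)
    have "measure lebesgue T \<le> measure lebesgue (T - Z) + measure lebesgue Z"
      using T(3) Zm by (subst TZ, intro measure_Un_le) auto
    also have "measure lebesgue (T - Z) < d"
      using T(3,4) d(1) by (simp add: emeasure_eq_measure2 ennreal_less_iff)
    finally show thesis using that T Tl Zl by simp
  qed
  \<comment> \<open>The gauge has two tasks: at points of \<open>Z\<close> it confines the ball to
    \<open>T\<close>, and at the other points of the interval it keeps the difference quotient below
    \<open>e1\<close>. Multiplied by the square of \<open>s - t\<close>, the latter reads the same
    on both sides of \<open>t\<close>.\<close>
  have "\<exists>g>0. if t \<in> Z then ball t g \<subseteq> T
     else t \<in> {a..b} \<longrightarrow> (\<forall>s\<in>{a..b}. \<bar>s - t\<bar> < g \<longrightarrow> (s - t) * (v s - v t) \<le> e1 * (s - t)\<^sup>2)" for t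
  proof (cases "t \<in> Z \<or> t \<notin> {a..b}")
    case True
    show ?thesis
    proof (cases "t \<in> Z")
      case tZ: True
      then show ?thesis using T(1,2) by (auto simp: open_contains_ball)
    next
      case False
      then show ?thesis using True by (intro exI[of _ 1]) auto
    qed
  next
    case False
    then obtain D where D: "D \<le> 0" "(v has_real_derivative D) (at t within {a..b})"
      using deriv by blast
    have "((\<lambda>s. (v s - v t) / (s - t)) \<longlongrightarrow> D) (at t within {a..b})"
      using D(2) by (simp add: has_field_derivative_iff)
    then have "\<forall>\<^sub>F s in at t within {a..b}. (v s - v t) / (s - t) < e1"
      by (rule order_tendstoD(2)) (use D(1) e1 in simp)
    then obtain g where g: "0 < g" "\<And>s. \<lbrakk>s \<in> {a..b}; s \<noteq> t; dist s t < g\<rbrakk> \<Longrightarrow> (v s - v t) / (s - t) < e1"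
      unfolding eventually_at by blast
    have "(s - t) * (v s - v t) \<le> e1 * (s - t)\<^sup>2" if s: "s \<in> {a..b}" "\<bar>s - t\<bar> < g" for s
    proof (cases "s = t")
      case False
      have "(s - t) * (v s - v t) = (v s - v t) / (s - t) * (s - t)\<^sup>2"
        using False by (simp add: power2_eq_square)
      also have "\<dots> \<le> e1 * (s - t)\<^sup>2"
        using g(2)[OF s(1) False] s(2) by (intro mult_right_mono) (auto simp: dist_real_def)
      finally show ?thesis .
    qed simp
    then show ?thesis using g(1) False by auto
  qed
  then obtain \<gamma> where \<gamma>: "\<And>t. 0 < \<gamma> t" "\<And>t. t \<in> Z \<Longrightarrow> ball t (\<gamma> t) \<subseteq> T"
    "\<And>t s. \<lbrakk>t \<notin> Z; t \<in> {a..b}; s \<in> {a..b}; \<bar>s - t\<bar> < \<gamma> t\<rbrakk> \<Longrightarrow> (s - t) * (v s - v t) \<le> e1 * (s - t)\<^sup>2"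
    by metis
  \<comment> \<open>Cousin's lemma provides a tagged division that is fine for this gauge.\<close>
  obtain p where p: "p tagged_division_of {a..b}" "(\<lambda>t. ball t (\<gamma> t)) fine p"
    using fine_division_exists_real[OF gauge_ball_dependent] \<gamma>(1) by metis
  have fin: "finite p" using p(1) by blast
  define u w where "u = (\<lambda>(t :: real, K :: real set). Inf K)" and "w = (\<lambda>(t :: real, K :: real set). Sup K)"
  have mem: "a \<le> u k \<and> u k \<le> fst k \<and> fst k \<le> w k \<and> w k \<le> b \<and> snd k = {u k..w k} \<and> {u k..w k} \<subseteq> ball (fst k) (\<gamma> (fst k))"
    if k: "k \<in> p" for k
  proof -
    obtain t K where [simp]: "k = (t, K)" by (cases k)
    have "(t, K) \<in> p" using k by simp
    then obtain c e where K: "K = cbox c e" using tagged_division_ofD(4)[OF p(1)] by blast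
    have "t \<in> K" "K \<subseteq> {a..b}" using tagged_division_ofD(2,3)[OF p(1)] k by auto
    moreover have "K \<subseteq> ball t (\<gamma> t)" using p(2) k by (auto simp: fine_def)
    ultimately show ?thesis using K by (auto simp: u_def w_def)
  qed
  have disj: "disjoint_family_on (\<lambda>k. {u k<..<w k}) p"
    unfolding disjoint_family_on_def
  proof (intro ballI impI)
    fix k l assume kl: "k \<in> p" "l \<in> p" "k \<noteq> l"
    have "interior (snd k) \<inter> interior (snd l) = {}"
      using tagged_division_ofD(5)[OF p(1), of "fst k" "snd k" "fst l" "snd l"] kl
      by (metis prod.collapse)
    then show "{u k<..<w k} \<inter> {u l<..<w l} = {}" using mem[OF kl(1)] mem[OF kl(2)] by simp
  qed
  have tele: "(\<Sum>k\<in>p. h (w k) - h (u k)) = h b - h a" for h :: "real \<Rightarrow> real"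
    using additive_tagged_division_1[OF \<open>a \<le> b\<close> p(1), of h] by (simp add: u_def w_def case_prod_unfold)
  define p1 where "p1 = {k \<in> p. fst k \<in> Z}"
  have p1: "finite p1" "p1 \<subseteq> p" using fin by (auto simp: p1_def)
  have disj1: "disjoint_family_on (\<lambda>k. {u k<..<w k}) p1"
    using disj p1(2) by (rule disjoint_family_on_mono[rotated])
  \<comment> \<open>The open intervals tagged in \<open>Z\<close> are disjoint and contained in
    \<open>T\<close>, so their total length is below \<open>d\<close>.\<close>
  have "(\<Sum>k\<in>p1. w k - u k) = (\<Sum>k\<in>p1. measure lebesgue {u k<..<w k})"
  proof (rule sum.cong[OF refl])
    fix k assume "k \<in> p1"
    then have "u k \<le> w k" using mem[of k] p1(2) by auto
    then show "w k - u k = measure lebesgue {u k<..<w k}" by simp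
  qed
  also have "\<dots> = measure lebesgue (\<Union>k\<in>p1. {u k<..<w k})"
  proof (rule measure_finite_Union[OF p1(1) _ disj1, symmetric])
    show "emeasure lebesgue {u k<..<w k} \<noteq> \<infinity>" for k
      using fmeasurableD2[OF lmeasurable_box, of "u k" "w k"] by simp
  qed auto
  also have "\<dots> \<le> measure lebesgue T"
  proof (rule measure_mono_fmeasurable[OF _ _ T(3)])
    show "(\<Union>k\<in>p1. {u k<..<w k}) \<subseteq> T"
      using mem \<gamma>(2) by (fastforce simp: p1_def subset_iff)
  qed (use p1(1) in auto)
  also have "\<dots> < d" by (rule T(4))
  finally have "(\<Sum>k\<in>p1. norm (v (w k) - v (u k))) < e / 2"
    using mem p1 disj1 by (intro d(2)) (auto intro: order_trans)
  moreover have "(\<Sum>k\<in>p1. v (w k) - v (u k)) \<le> (\<Sum>k\<in>p1. norm (v (w k) - v (u k)))"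
    by (intro sum_mono) simp
  ultimately have s1: "(\<Sum>k\<in>p1. v (w k) - v (u k)) < e / 2" by linarith
  \<comment> \<open>The tag splits its interval in two, and the slope bound at the tag applies to
    each half.\<close>
  have "(\<Sum>k\<in>p-p1. v (w k) - v (u k)) \<le> (\<Sum>k\<in>p-p1. e1 * (w k - u k))"
  proof (rule sum_mono)
    fix k assume k: "k \<in> p - p1"
    define t where "t = fst k"
    have m: "a \<le> u k" "u k \<le> t" "t \<le> w k" "w k \<le> b" and sub: "{u k..w k} \<subseteq> ball t (\<gamma> t)"
      using mem[of k] k by (auto simp: t_def)
    have m': "\<bar>u k - t\<bar> < \<gamma> t" "\<bar>w k - t\<bar> < \<gamma> t"
      using subsetD[OF sub, of "u k"] subsetD[OF sub, of "w k"] m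
      by (auto simp: dist_real_def abs_minus_commute)
    have tZ: "t \<notin> Z" "t \<in> {a..b}" using k m by (auto simp: p1_def t_def)
    have 1: "(u k - t) * (v (u k) - v t) \<le> e1 * (u k - t)\<^sup>2" "(w k - t) * (v (w k) - v t) \<le> e1 * (w k - t)\<^sup>2"
      using m m' tZ by (intro \<gamma>(3); simp)+
    have "v t - v (u k) \<le> e1 * (t - u k)"
    proof (cases "u k = t")
      case False
      then have "(t - u k) * (v t - v (u k)) \<le> (t - u k) * (e1 * (t - u k))"
        using 1(1) by (simp add: power2_eq_square algebra_simps)
      then show ?thesis using False m by (simp add: mult_le_cancel_left)
    qed simp
    moreover have "v (w k) - v t \<le> e1 * (w k - t)"
    proof (cases "w k = t")
      case False
      then have "(w k - t) * (v (w k) - v t) \<le> (w k - t) * (e1 * (w k - t))"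
        using 1(2) by (simp add: power2_eq_square algebra_simps)
      then show ?thesis using False m by (simp add: mult_le_cancel_left)
    qed simp
    ultimately show "v (w k) - v (u k) \<le> e1 * (w k - u k)" by (simp add: algebra_simps)
  qed
  \<comment> \<open>Restoring the intervals tagged in \<open>Z\<close> can only increase the total
    length, which then telescopes to \<open>b - a\<close>.\<close>
  also have "\<dots> \<le> (\<Sum>k\<in>p. e1 * (w k - u k))"
  proof (rule sum_mono2[OF fin])
    fix k assume "k \<in> p - (p - p1)"
    then have "u k \<le> w k" using mem[of k] by auto
    then show "0 \<le> e1 * (w k - u k)" using e1 by simp
  qed blast
  also have "\<dots> = e1 * (b - a)"
    using tele[of "\<lambda>x. x"] by (simp flip: sum_distrib_left)
  also have "\<dots> \<le> e1 * (b - a + 1)" using e1 by simp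
  also have "\<dots> = e / 2"
    using \<open>a \<le> b\<close> nonzero_eq_divide_eq[of "b - a + 1" e1 "e / 2"] e1_def by linarith
  finally have s2: "(\<Sum>k\<in>p-p1. v (w k) - v (u k)) \<le> e / 2" .
  have "v b - v a = (\<Sum>k\<in>p-p1. v (w k) - v (u k)) + (\<Sum>k\<in>p1. v (w k) - v (u k))"
    using tele[of v] sum.subset_diff[OF p1(2) fin] by metis
  then show "v b \<le> v a + e" using s1 s2 by linarith
qed

section \<open>Functions pieced together from absolutely continuous ones\<close>

text \<open>A piece that contains \<open>u\<close> is followed up to the last time at which it is
  occupied. From there on the other pieces cover the interval, so each piece is used for one
  subinterval at most, however often the function switches, and the induction removes one piece at a
  time.\<close>

lemma piecewise_increment:
  fixes v :: "real \<Rightarrow> 'a::ab_group_add"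
  assumes "finite K" "u \<le> w" "{u..w} \<subseteq> (\<Union>k\<in>K. S k)" "\<And>k. k \<in> K \<Longrightarrow> closed (S k)"
    and "\<And>k t. \<lbrakk>k \<in> K; t \<in> S k; u \<le> t; t \<le> w\<rbrakk> \<Longrightarrow> v t = F k t"
  shows "\<exists>p q. (\<forall>k\<in>K. u \<le> p k \<and> p k \<le> q k \<and> q k \<le> w) \<and>
    v w - v u = (\<Sum>k\<in>K. F k (q k) - F k (p k))"
  using assms
proof (induction K arbitrary: u rule: finite_psubset_induct)
  case (psubset K)
  obtain k where k: "k \<in> K" "u \<in> S k" using psubset.prems(1,2) by force
  \<comment> \<open>The last time in \<open>S k\<close>; it belongs to \<open>S k\<close> because
    that set is closed.\<close>
  define w' where "w' = Sup (S k \<inter> {u..w})"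
  have ne: "S k \<inter> {u..w} \<noteq> {}" using k psubset.prems(1) by auto
  have w': "w' \<in> S k" "u \<le> w'" "w' \<le> w"
    using closed_contains_Sup[OF ne] psubset.prems(3)[OF k(1)] by (auto simp: w'_def closed_Int)
  have above: "t \<notin> S k" if "w' < t" "t \<le> w" for t
    using cSup_upper[of t "S k \<inter> {u..w}"] that w' by (force simp: w'_def)
  have fin: "finite K" by fact
  have vw': "v w' - v u = F k w' - F k u"
    using psubset.prems(4)[OF k(1)] k(2) w' psubset.prems(1) by simp
  have sub: "K - {k} \<subset> K" using k by auto
  have K: "(\<Sum>l\<in>K. h l) = h k + (\<Sum>l\<in>K-{k}. h l)" for h :: "_ \<Rightarrow> 'a"
    using k fin by (simp add: sum.remove)
  show ?case
  proof (cases "w' = w")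
    case True
    show ?thesis
    proof (intro exI conjI)
      \<comment> \<open>The piece \<open>k\<close> reaches the right end alone; the others receive
        the degenerate interval at \<open>u\<close>.\<close>
      show "\<forall>l\<in>K. u \<le> u \<and> u \<le> (if l = k then w else u) \<and> (if l = k then w else u) \<le> w"
        using psubset.prems(1) by auto
      show "v w - v u = (\<Sum>l\<in>K. F l (if l = k then w else u) - F l u)"
        unfolding K using vw' True by simp
    qed
  next
    case False
    then have lt: "w' < w" using w' by simp
    have cov: "{w'<..w} \<subseteq> (\<Union>l\<in>K-{k}. S l)"
    proof
      fix t assume t: "t \<in> {w'<..w}"
      then have "t \<in> (\<Union>l\<in>K. S l)" using psubset.prems(2) w'(2) by (auto simp: subset_iff)
      then show "t \<in> (\<Union>l\<in>K-{k}. S l)" using above t by auto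
    qed
    have cl: "closed (\<Union>l\<in>K-{k}. S l)" using fin psubset.prems(3) by auto
    \<comment> \<open>The remaining pieces cover only the half-open interval a priori; being closed,
      they also cover its left end, as the induction hypothesis demands.\<close>
    have "{w'..w} = closure {w'<..w}" using lt by simp
    also have "\<dots> \<subseteq> (\<Union>l\<in>K-{k}. S l)" using cov cl by (rule closure_minimal)
    finally have cov': "{w'..w} \<subseteq> (\<Union>l\<in>K-{k}. S l)" .
    obtain p q where pq: "\<forall>l\<in>K-{k}. w' \<le> p l \<and> p l \<le> q l \<and> q l \<le> w"
      "v w - v w' = (\<Sum>l\<in>K-{k}. F l (q l) - F l (p l))"
    proof -
      have "\<exists>p q. (\<forall>l\<in>K-{k}. w' \<le> p l \<and> p l \<le> q l \<and> q l \<le> w) \<and>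
          v w - v w' = (\<Sum>l\<in>K-{k}. F l (q l) - F l (p l))"
        using psubset.prems(4) w' by (intro psubset.IH[OF sub w'(3) cov'] psubset.prems(3)) auto
      then show thesis using that by blast
    qed
    show ?thesis
    proof (intro exI conjI)
      show "\<forall>l\<in>K. u \<le> (p(k := u)) l \<and> (p(k := u)) l \<le> (q(k := w')) l \<and> (q(k := w')) l \<le> w"
        using pq(1) w' by force
      have "(\<Sum>l\<in>K. F l ((q(k := w')) l) - F l ((p(k := u)) l))
          = (F k w' - F k u) + (\<Sum>l\<in>K-{k}. F l (q l) - F l (p l))"
        unfolding K by (intro arg_cong2[of _ _ _ _ "(+)"] sum.cong) auto
      then show "v w - v u = (\<Sum>l\<in>K. F l ((q(k := w')) l) - F l ((p(k := u)) l))"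
        using pq(2) vw' by (metis (no_types, lifting) add.commute diff_add_cancel add_diff_eq)
    qed
  qed
qed

text \<open>Each increment of \<open>v\<close> is a sum of one increment of every \<open>F k\<close>
  over a subinterval. For a fixed \<open>k\<close> these subintervals inherit disjointness and small
  total length, so absolute continuity of \<open>F k\<close> applies, and finitely many such bounds
  are added.\<close>

lemma abs_continuous_piecewise:
  fixes v :: "real \<Rightarrow> 'a::real_normed_vector" and F :: "'k \<Rightarrow> real \<Rightarrow> 'a"
  assumes K: "finite K" and cov: "{a..b} \<subseteq> (\<Union>k\<in>K. S k)" and cl: "\<And>k. k \<in> K \<Longrightarrow> closed (S k)"
    and v: "\<And>k t. \<lbrakk>k \<in> K; t \<in> S k; a \<le> t; t \<le> b\<rbrakk> \<Longrightarrow> v t = F k t"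
    and F: "\<And>k. k \<in> K \<Longrightarrow> abs_continuous_on_interval a b (F k)"
  shows "abs_continuous_on_interval a b v"
  unfolding abs_continuous_on_interval_def
proof (intro allI impI)
  fix e :: real assume e: "0 < e"
  \<comment> \<open>With one more share than there are pieces, the sum of the bounds stays strictly
    below \<open>e\<close>, and \<open>K\<close> may be empty.\<close>
  define e' where "e' = e / (real (card K) + 1)"
  have e': "0 < e'" using e by (simp add: e'_def)
  define good where "good k d \<longleftrightarrow> 0 < d \<and> (\<forall>(n::nat) u v.
       (\<forall>i<n. a \<le> u i \<and> u i \<le> v i \<and> v i \<le> b) \<and>
       (\<forall>i<n. \<forall>l<n. i \<noteq> l \<longrightarrow> {u i<..<v i} \<inter> {u l<..<v l} = {}) \<and>
       (\<Sum>i<n. v i - u i) < d \<longrightarrow> (\<Sum>i<n. norm (F k (v i) - F k (u i))) < e')" for k d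
  have "\<forall>k\<in>K. \<exists>d. good k d"
    using F e' unfolding abs_continuous_on_interval_def good_def by blast
  then obtain d where good: "\<And>k. k \<in> K \<Longrightarrow> good k (d k)"
    by metis
  \<comment> \<open>The inserted 1 keeps the minimum meaningful for empty \<open>K\<close>.\<close>
  define \<delta> where "\<delta> = Min (insert 1 (d ` K))"
  have \<delta>: "0 < \<delta>" "\<And>k. k \<in> K \<Longrightarrow> \<delta> \<le> d k"
    using K good by (auto simp: \<delta>_def good_def)
  show "\<exists>d>0. \<forall>(n::nat) u w.
       (\<forall>k<n. a \<le> u k \<and> u k \<le> w k \<and> w k \<le> b) \<and>
       (\<forall>k<n. \<forall>l<n. k \<noteq> l \<longrightarrow> {u k<..<w k} \<inter> {u l<..<w l} = {}) \<and>
       (\<Sum>k<n. w k - u k) < d \<longrightarrow> (\<Sum>k<n. norm (v (w k) - v (u k))) < e"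
  proof (intro exI[of _ \<delta>] conjI allI impI, fact \<delta>(1), elim conjE)
    fix n :: nat and u w :: "nat \<Rightarrow> real"
    assume uw: "\<forall>k<n. a \<le> u k \<and> u k \<le> w k \<and> w k \<le> b"
      and disj: "\<forall>k<n. \<forall>l<n. k \<noteq> l \<longrightarrow> {u k<..<w k} \<inter> {u l<..<w l} = {}"
      and len: "(\<Sum>k<n. w k - u k) < \<delta>"
    have "\<exists>p q. (\<forall>k\<in>K. u i \<le> p k \<and> p k \<le> q k \<and> q k \<le> w i) \<and>
        v (w i) - v (u i) = (\<Sum>k\<in>K. F k (q k) - F k (p k))" if "i < n" for i
    proof -
      have i: "a \<le> u i" "u i \<le> w i" "w i \<le> b" using uw that by auto
      have "{u i..w i} \<subseteq> (\<Union>k\<in>K. S k)" using i cov by (auto simp: subset_iff)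
      then show ?thesis
        using i by (intro piecewise_increment[OF K i(2), where S = S] cl v) auto
    qed
    then have "\<forall>i\<in>{..<n}. \<exists>p q. (\<forall>k\<in>K. u i \<le> p k \<and> p k \<le> q k \<and> q k \<le> w i) \<and>
        v (w i) - v (u i) = (\<Sum>k\<in>K. F k (q k) - F k (p k))" by blast
    from bchoice[OF this] obtain p where
      "\<forall>i\<in>{..<n}. \<exists>q. (\<forall>k\<in>K. u i \<le> p i k \<and> p i k \<le> q k \<and> q k \<le> w i) \<and>
        v (w i) - v (u i) = (\<Sum>k\<in>K. F k (q k) - F k (p i k))" by blast
    from bchoice[OF this] obtain q where
      pq: "\<And>i k. \<lbrakk>i < n; k \<in> K\<rbrakk> \<Longrightarrow> u i \<le> p i k \<and> p i k \<le> q i k \<and> q i k \<le> w i"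
      "\<And>i. i < n \<Longrightarrow> v (w i) - v (u i) = (\<Sum>k\<in>K. F k (q i k) - F k (p i k))"
      by auto
    have Fk: "(\<Sum>i<n. norm (F k (q i k) - F k (p i k))) \<le> e'" if k: "k \<in> K" for k
    proof (rule less_imp_le, rule good[OF k, unfolded good_def, THEN conjunct2, rule_format], intro conjI)
      show "\<forall>i<n. a \<le> p i k \<and> p i k \<le> q i k \<and> q i k \<le> b"
        using uw pq(1)[OF _ k] by (meson order_trans)
      show "\<forall>i<n. \<forall>l<n. i \<noteq> l \<longrightarrow> {p i k<..<q i k} \<inter> {p l k<..<q l k} = {}"
      proof (intro allI impI)
        fix i l assume il: "i < n" "l < n" "i \<noteq> l"
        have "{p i k<..<q i k} \<subseteq> {u i<..<w i}" "{p l k<..<q l k} \<subseteq> {u l<..<w l}"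
          using pq(1)[OF il(1) k] pq(1)[OF il(2) k] by auto
        then show "{p i k<..<q i k} \<inter> {p l k<..<q l k} = {}" using disj il by blast
      qed
      have "(\<Sum>i<n. q i k - p i k) \<le> (\<Sum>i<n. w i - u i)"
        using pq(1)[OF _ k] by (intro sum_mono diff_mono) auto
      also have "\<dots> < d k" using len \<delta>(2)[OF k] by simp
      finally show "(\<Sum>i<n. q i k - p i k) < d k" .
    qed
    have "(\<Sum>i<n. norm (v (w i) - v (u i))) \<le> (\<Sum>i<n. \<Sum>k\<in>K. norm (F k (q i k) - F k (p i k)))"
      by (intro sum_mono) (simp add: pq(2) norm_sum)
    also have "\<dots> = (\<Sum>k\<in>K. \<Sum>i<n. norm (F k (q i k) - F k (p i k)))"
      by (rule sum.swap)
    also have "\<dots> \<le> real (card K) * e'"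
      using Fk by (intro sum_bounded_above) auto
    also have "\<dots> < (real (card K) + 1) * e'" using e' by simp
    also have "\<dots> = e" by (simp add: e'_def)
    finally show "(\<Sum>i<n. norm (v (w i) - v (u i))) < e" .
  qed
qed

text \<open>Both derivatives survive restriction to \<open>S\<close>, where the functions coincide,
  and limits within \<open>S\<close> at a limit point of \<open>S\<close> are unique.\<close>

lemma DERIV_eq_on_limit_set:
  fixes f g :: "real \<Rightarrow> real"
  assumes f: "(f has_real_derivative d) (at t within I)"
    and g: "(g has_real_derivative e) (at t within I)"
    and S: "S \<subseteq> I" "t \<in> S" "t islimpt S" "\<And>s. s \<in> S \<Longrightarrow> f s = g s"
  shows "d = e"
proof -
  have "(f has_real_derivative e) (at t within S)"
    using DERIV_subset[OF g S(1)] zero_less_one S(2)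
    by (rule has_field_derivative_transform_within) (use S(4) in auto)
  moreover have "(f has_real_derivative d) (at t within S)" using f S(1) by (rule DERIV_subset)
  ultimately show ?thesis
    using S(3) tendsto_unique[of "at t within S"]
    unfolding has_field_derivative_iff trivial_limit_within by blast
qed

lemma has_field_derivative_finite_Union:
  assumes "finite K" "\<And>k. k \<in> K \<Longrightarrow> (f has_field_derivative d) (at t within S k)"
  shows "(f has_field_derivative d) (at t within (\<Union>k\<in>K. S k))"
  using assms
proof induction
  case empty
  then show ?case by (simp add: has_field_derivative_iff)
next
  case (insert k K)
  then show ?case by (auto simp: has_field_derivative_iff intro: Lim_Un)
qed

text \<open>Assumption \<open>le\<close> controls the derivative of only one of the pieces occupied
  at \<open>t\<close>. Outside a null set all pieces occupied at \<open>t\<close> share that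
  derivative, so \<open>v\<close> is itself differentiable there with nonpositive
  derivative.\<close>

lemma piecewise_nonincreasing:
  fixes v :: "real \<Rightarrow> real" and F :: "'k \<Rightarrow> real \<Rightarrow> real"
  assumes "a \<le> b" and K: "finite K"
    and S: "\<And>k. k \<in> K \<Longrightarrow> closed (S k)" "(\<Union>k\<in>K. S k) = {a..b}"
    and v: "\<And>k t. \<lbrakk>k \<in> K; t \<in> S k\<rbrakk> \<Longrightarrow> v t = F k t"
    and F: "\<And>k. k \<in> K \<Longrightarrow> abs_continuous_on_interval a b (F k)"
    and Z: "negligible Z"
    and diff: "\<And>k t. \<lbrakk>k \<in> K; t \<in> {a..b}; t \<notin> Z\<rbrakk> \<Longrightarrow> \<exists>d. (F k has_real_derivative d) (at t within {a..b})"
    and le: "\<And>t. \<lbrakk>t \<in> {a..b}; t \<notin> Z\<rbrakk> \<Longrightarrow>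
      \<exists>k\<in>K. t \<in> S k \<and> (\<exists>d\<le>0. (F k has_real_derivative d) (at t within {a..b}))"
  shows "v b \<le> v a"
proof -
  \<comment> \<open>Added to \<open>Z\<close> are the isolated points of the pairwise overlaps, a
    countable set.\<close>
  define Z' where "Z' = Z \<union> (\<Union>k\<in>K. \<Union>l\<in>K. {t \<in> S k \<inter> S l. \<not> t islimpt (S k \<inter> S l)})"
  have Z': "negligible Z'"
  proof -
    have "countable (\<Union>k\<in>K. \<Union>l\<in>K. {t \<in> S k \<inter> S l. \<not> t islimpt (S k \<inter> S l)})"
      using K by (intro countable_UN countable_finite countable_isolated_points)
    then show ?thesis
      unfolding Z'_def using Z
      by (intro negligible_Un)
        (simp_all add: negligible_iff_null_sets null_sets_completionI countable_imp_null_set_lborel)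
  qed
  show ?thesis
  proof (rule abs_continuous_nonincreasing[OF \<open>a \<le> b\<close> _ Z'])
    show "abs_continuous_on_interval a b v"
      using S v F by (intro abs_continuous_piecewise[OF K, of a b S v F]) auto
    fix t assume t: "t \<in> {a..b}" "t \<notin> Z'"
    then have tZ: "t \<notin> Z" by (simp add: Z'_def)
    obtain k d where k: "k \<in> K" "t \<in> S k" "d \<le> 0" "(F k has_real_derivative d) (at t within {a..b})"
      using le[OF t(1) tZ] by blast
    have "(v has_real_derivative d) (at t within S l)" if l: "l \<in> K" for l
    proof (cases "t \<in> S l")
      case True
      obtain e where e: "(F l has_real_derivative e) (at t within {a..b})"
        using diff[OF l t(1) tZ] by blast
      \<comment> \<open>Since \<open>t\<close> avoids \<open>Z'\<close>, it is not isolated in the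
        overlap, so the derivatives of the two pieces can be compared along it.\<close>
      have "t islimpt (S k \<inter> S l)" using t(2) k(1,2) l True by (auto simp: Z'_def)
      then have "d = e"
        using S(2) k(1,2) l True v
        by (intro DERIV_eq_on_limit_set[OF k(4) e, of "S k \<inter> S l"]) (auto simp flip: v)
      then have "(F l has_real_derivative d) (at t within S l)"
        using e S(2) l by (auto intro: DERIV_subset)
      then show ?thesis
        using zero_less_one True by (rule has_field_derivative_transform_within) (use v[OF l] in auto)
    next
      case False
      \<comment> \<open>A closed piece not containing \<open>t\<close> stays away from it, so
        differentiability within that piece holds vacuously.\<close>
      then have "at t within S l = bot"
        using S(1)[OF l] closed_limpt trivial_limit_within by blast
      then show ?thesis by (simp add: has_field_derivative_iff)
    qed
    then have "(v has_real_derivative d) (at t within (\<Union>k\<in>K. S k))"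
      by (rule has_field_derivative_finite_Union[OF K])
    then have "(v has_real_derivative d) (at t within {a..b})" by (simp only: S(2))
    then show "\<exists>d\<le>0. (v has_real_derivative d) (at t within {a..b})" using k(3) by blast
  qed
qed

text \<open>With the integrating factor \<open>exp (c * t)\<close> the differential inequality for
  \<open>F k\<close> becomes a nonpositive derivative of \<open>exp (c * t) * F k t\<close>.\<close>

lemma piecewise_exponential_decay:
  fixes v :: "real \<Rightarrow> real" and F :: "'k \<Rightarrow> real \<Rightarrow> real"
  assumes "a \<le> b" and K: "finite K"
    and S: "\<And>k. k \<in> K \<Longrightarrow> closed (S k)" "(\<Union>k\<in>K. S k) = {a..b}"
    and v: "\<And>k t. \<lbrakk>k \<in> K; t \<in> S k\<rbrakk> \<Longrightarrow> v t = F k t"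
    and F: "\<And>k. k \<in> K \<Longrightarrow> abs_continuous_on_interval a b (F k)"
    and Z: "negligible Z"
    and diff: "\<And>k t. \<lbrakk>k \<in> K; t \<in> {a..b}; t \<notin> Z\<rbrakk> \<Longrightarrow> \<exists>d. (F k has_real_derivative d) (at t within {a..b})"
    and le: "\<And>t. \<lbrakk>t \<in> {a..b}; t \<notin> Z\<rbrakk> \<Longrightarrow> \<exists>k\<in>K. t \<in> S k \<and>
      (\<exists>d. d \<le> - c * F k t \<and> (F k has_real_derivative d) (at t within {a..b}))"
  shows "v b \<le> exp (- c * (b - a)) * v a"
proof -
  have ac: "abs_continuous_on_interval a b (\<lambda>t. exp (c * t))"
  proof -
    \<comment> \<open>The derivative of the integrating factor is bounded on the compact interval,
      which makes the factor Lipschitz.\<close>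
    have "bounded ((\<lambda>t. c * exp (c * t)) ` {a..b})"
      by (intro compact_imp_bounded compact_continuous_image continuous_intros) auto
    then obtain L where L: "0 < L" "\<And>t. t \<in> {a..b} \<Longrightarrow> norm (c * exp (c * t)) \<le> L"
      unfolding bounded_pos by (auto simp: image_iff)
    have "L-lipschitz_on {a..b} (\<lambda>t. exp (c * t))"
    proof (rule bounded_derivative_imp_lipschitz[where f' = "\<lambda>t h. c * exp (c * t) * h"])
      fix t assume t: "t \<in> {a..b}"
      show "((\<lambda>t. exp (c * t)) has_derivative (\<lambda>h. c * exp (c * t) * h)) (at t within {a..b})"
        by (auto intro!: derivative_eq_intros)
      show "onorm (\<lambda>h. c * exp (c * t) * h) \<le> L"
        using L(2)[OF t] L(1) by (intro onorm_le) (auto simp: abs_mult intro!: mult_right_mono)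
    qed (use L in auto)
    then show ?thesis by (rule lipschitz_imp_abs_continuous)
  qed
  have "exp (c * b) * v b \<le> exp (c * a) * v a"
  proof (rule piecewise_nonincreasing[OF \<open>a \<le> b\<close> K S _ _ Z, where F = "\<lambda>k t. exp (c * t) * F k t"])
    show "abs_continuous_on_interval a b (\<lambda>t. exp (c * t) * F k t)" if "k \<in> K" for k
      using F[OF that] ac by (rule abs_continuous_bilinear[OF bounded_bilinear_mult, rotated])
    have D: "((\<lambda>t. exp (c * t) * F k t) has_real_derivative exp (c * t) * (d + c * F k t)) (at t within {a..b})"
      if "(F k has_real_derivative d) (at t within {a..b})" for k t d
      using that by (auto intro!: derivative_eq_intros simp: algebra_simps)
    show "\<exists>d. ((\<lambda>t. exp (c * t) * F k t) has_real_derivative d) (at t within {a..b})"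
      if "k \<in> K" "t \<in> {a..b}" "t \<notin> Z" for k t
      using diff[OF that] D by blast
    fix t assume "t \<in> {a..b}" "t \<notin> Z"
    from le[OF this] obtain k d where k: "k \<in> K" "t \<in> S k" "d \<le> - c * F k t"
      "(F k has_real_derivative d) (at t within {a..b})" by blast
    show "\<exists>k\<in>K. t \<in> S k \<and>
        (\<exists>d\<le>0. ((\<lambda>t. exp (c * t) * F k t) has_real_derivative d) (at t within {a..b}))"
    proof (intro bexI[OF _ k(1)] conjI exI)
      show "exp (c * t) * (d + c * F k t) \<le> 0" using k(3) by (simp add: mult_le_0_iff)
    qed (use k D in auto)
  qed (use v in auto)
  then have "exp (- c * b) * (exp (c * b) * v b) \<le> exp (- c * b) * (exp (c * a) * v a)"
    by simp
  moreover have "exp (- c * b) * exp (c * b) = 1" "exp (- c * b) * exp (c * a) = exp (- c * (b - a))"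
    by (simp_all add: right_diff_distrib flip: exp_add)
  ultimately show ?thesis by (metis mult.assoc mult_1 minus_mult_left)
qed

section \<open>Quadratic forms of block matrices\<close>

lemma inner_transpose_mult:
  fixes M :: "real^'n^'m"
  shows "x \<bullet> (transpose M *v y) = (M *v x) \<bullet> y"
  by (metis dot_lmul_matrix inner_commute transpose_matrix_vector)

lemma mat_mult_vec: "mat k *v x = k *\<^sub>R (x :: real^'n)"
  by (simp add: vec_eq_iff matrix_vector_mult_def mat_def if_distrib[where f = "\<lambda>y. y * _"] cong: if_cong)

lemma scaleR_mult_vec: "(k *\<^sub>R M) *v x = k *\<^sub>R (M *v (x :: real^'n))"
  by (rule scaleR_matrix_vector_assoc[symmetric])

lemma uminus_mult_vec: "(- M) *v x = - (M *v (x :: real^'n))"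
  by (simp add: vec_eq_iff matrix_vector_mult_def sum_negf)

lemma vec_append_add: "(x <@> y) + (x' <@> y') = (x + x' :: real^'m) <@> (y + y' :: real^'n)"
  by (simp add: vec_eq_iff vec_append_def split: sum.split)

lemma vec_append_diff: "(x <@> y) - (x' <@> y') = (x - x' :: real^'m) <@> (y - y' :: real^'n)"
  by (simp add: vec_eq_iff vec_append_def split: sum.split)

lemma vec_append_scaleR: "k *\<^sub>R (x <@> y) = (k *\<^sub>R (x :: real^'m)) <@> (k *\<^sub>R (y :: real^'n))"
  by (simp add: vec_eq_iff vec_append_def split: sum.split)

lemma norm_vec_append_le: "norm (x <@> y) \<le> norm x + norm (y :: real^'n)" for x :: "real^'m"
proof -
  have "norm (x <@> y) = sqrt ((norm x)\<^sup>2 + (norm y)\<^sup>2)"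
    by (simp add: norm_eq_sqrt_inner inner_vec_append)
  then show ?thesis by (simp add: sqrt_sum_squares_le_sum)
qed

section \<open>Derivatives along augmented trajectories\<close>

lemma has_vector_derivative_vec_append:
  fixes x :: "real \<Rightarrow> real^'m" and y :: "real \<Rightarrow> real^'n"
  assumes "(x has_vector_derivative x') (at t within T)" "(y has_vector_derivative y') (at t within T)"
  shows "((\<lambda>t. x t <@> y t) has_vector_derivative (x' <@> y')) (at t within T)"
proof -
  have bl: "bounded_linear (\<lambda>w :: (real^'m) \<times> (real^'n). fst w <@> snd w)"
    by (intro linear_conv_bounded_linear[THEN iffD1] linearI)
      (auto simp: vec_append_add vec_append_scaleR)
  show ?thesis
    using bounded_linear.has_vector_derivative[OF bl has_vector_derivative_Pair[OF assms]] by simp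
qed

lemma has_vector_derivative_aug:
  fixes x y :: "real \<Rightarrow> real^'n"
  assumes "(x has_vector_derivative x') (at t within T)" "(y has_vector_derivative y') (at t within T)"
  shows "((\<lambda>t. aug (x t) (y t)) has_vector_derivative (x' <@> y' <@> 0)) (at t within T)"
  unfolding aug_def
  by (intro has_vector_derivative_vec_append assms has_vector_derivative_const)

text \<open>The product rule yields two terms, which coincide by symmetry of
  \<open>P\<close>.\<close>

lemma has_real_derivative_quadratic_form:
  fixes z :: "real \<Rightarrow> real^'k"
  assumes "(z has_vector_derivative z') (at t within T)" "transpose P = P"
  shows "((\<lambda>t. z t \<bullet> (P *v z t)) has_real_derivative 2 * (z t \<bullet> (P *v z'))) (at t within T)"
proof -
  have "((\<lambda>t. P *v z t) has_vector_derivative P *v z') (at t within T)"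
    by (rule bounded_linear.has_vector_derivative[OF matrix_vector_mul_bounded_linear assms(1)])
  from bounded_bilinear.has_vector_derivative[OF bounded_bilinear_inner assms(1) this]
  have "((\<lambda>t. z t \<bullet> (P *v z t)) has_real_derivative z t \<bullet> (P *v z') + z' \<bullet> (P *v z t)) (at t within T)"
    by (simp only: has_real_derivative_iff_has_vector_derivative)
  moreover have "z' \<bullet> (P *v z t) = z t \<bullet> (P *v z')"
    using inner_transpose_mult[of z' P "z t"] assms(2) by (simp add: inner_commute)
  ultimately show ?thesis by simp
qed

lemma congruence_quadratic_form:
  "z \<bullet> (congruence p H U *v z) = (\<Sum>r<p. \<Sum>s<p. (H r \<bullet> z) * U r s * (H s \<bullet> z))"
proof -
  have "z \<bullet> (congruence p H U *v z)
      = (\<Sum>a\<in>UNIV. \<Sum>b\<in>UNIV. \<Sum>r<p. \<Sum>s<p. (H r $ a * z $ a) * U r s * (H s $ b * z $ b))"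
    by (simp add: inner_vec_def matrix_vector_mult_def congruence_def sum_distrib_left
        sum_distrib_right mult_ac)
  \<comment> \<open>Four exchanges move \<open>r\<close> and \<open>s\<close> outermost; the inner
    sums over coordinates then factor into inner products.\<close>
  also have "\<dots> = (\<Sum>a\<in>UNIV. \<Sum>r<p. \<Sum>b\<in>UNIV. \<Sum>s<p. (H r $ a * z $ a) * U r s * (H s $ b * z $ b))"
    by (rule sum.cong[OF refl], rule sum.swap)
  also have "\<dots> = (\<Sum>r<p. \<Sum>a\<in>UNIV. \<Sum>b\<in>UNIV. \<Sum>s<p. (H r $ a * z $ a) * U r s * (H s $ b * z $ b))"
    by (rule sum.swap)
  also have "\<dots> = (\<Sum>r<p. \<Sum>a\<in>UNIV. \<Sum>s<p. \<Sum>b\<in>UNIV. (H r $ a * z $ a) * U r s * (H s $ b * z $ b))"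
    by (rule sum.cong[OF refl], rule sum.cong[OF refl], rule sum.swap)
  also have "\<dots> = (\<Sum>r<p. \<Sum>s<p. \<Sum>a\<in>UNIV. \<Sum>b\<in>UNIV. (H r $ a * z $ a) * U r s * (H s $ b * z $ b))"
    by (rule sum.cong[OF refl], rule sum.swap)
  also have "\<dots> = (\<Sum>r<p. \<Sum>s<p. (H r \<bullet> z) * U r s * (H s \<bullet> z))"
    by (intro sum.cong refl) (simp add: inner_vec_def sum_distrib_left sum_distrib_right mult_ac)
  finally show ?thesis .
qed

text \<open>Every term of the double sum has three nonnegative factors. This is the S-procedure:
  matrix inequalities containing such a term yield bounds on the region where the rows of
  \<open>H\<close> are nonnegative.\<close>

lemma congruence_quadratic_form_nonneg:
  assumes "sym_nonneg_zero_diag p U" "\<And>r. r < p \<Longrightarrow> 0 \<le> H r \<bullet> z"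
  shows "0 \<le> z \<bullet> (congruence p H U *v z)"
  unfolding congruence_quadratic_form using assms
  by (intro sum_nonneg mult_nonneg_nonneg) (auto simp: sym_nonneg_zero_diag_def)

text \<open>The quadratic form of the block matrix is evaluated at the state stacked on the input.
  Symmetry of \<open>P\<close> merges the two drift terms, and the terms in \<open>C\<close> and
  \<open>D\<close> complete the square of the output. \<open>S\<close> and \<open>T\<close> stay
  general so that single and augmented systems are both instances.\<close>

lemma lmi_dissipation:
  fixes A P S :: "real^'k^'k" and B :: "real^'u^'k" and C :: "real^'k^'q" and D :: "real^'u^'q"
    and T :: "real^'u^'u"
  assumes lmi: "neg_semidef
      (transpose A ** P + P ** A + transpose C ** C + S <|> P ** B + transpose C ** D </>
       transpose (P ** B + transpose C ** D) <|> transpose D ** D - T)"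
    and P: "transpose P = P"
  shows "2 * (z \<bullet> (P *v (A *v z + B *v u))) + (norm (C *v z + D *v u))\<^sup>2 + z \<bullet> (S *v z) \<le> u \<bullet> (T *v u)"
proof -
  have PA: "(A *v z) \<bullet> (P *v z) = z \<bullet> (P *v (A *v z))"
    using inner_transpose_mult[of "A *v z" P z] P by (simp add: inner_commute)
  have "(z <@> u) \<bullet> ((transpose A ** P + P ** A + transpose C ** C + S <|> P ** B + transpose C ** D </>
       transpose (P ** B + transpose C ** D) <|> transpose D ** D - T) *v (z <@> u)) \<le> 0"
    using lmi unfolding neg_semidef_def by blast
  then have "(A *v z) \<bullet> (P *v z) + z \<bullet> (P *v (A *v z)) + (C *v z) \<bullet> (C *v z) + z \<bullet> (S *v z)
      + (z \<bullet> (P *v (B *v u)) + (C *v z) \<bullet> (D *v u)) + ((P *v (B *v u)) \<bullet> z + (transpose C *v (D *v u)) \<bullet> z)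
      + ((D *v u) \<bullet> (D *v u) - u \<bullet> (T *v u)) \<le> 0"
    by (simp add: above_mult_vec beside_mult_vec inner_vec_append matrix_vector_mult_add_rdistrib
        matrix_vector_mult_diff_rdistrib inner_add_left inner_add_right inner_diff_right
        inner_transpose_mult del: transpose_matrix_vector flip: matrix_vector_mul_assoc)
  moreover have "(P *v (B *v u)) \<bullet> z = z \<bullet> (P *v (B *v u))" by (rule inner_commute)
  moreover have "(transpose C *v (D *v u)) \<bullet> z = (C *v z) \<bullet> (D *v u)"
    using inner_transpose_mult[of z C "D *v u"] by (simp only: inner_commute)
  moreover have "(norm (C *v z + D *v u))\<^sup>2
      = (C *v z) \<bullet> (C *v z) + 2 * ((C *v z) \<bullet> (D *v u)) + (D *v u) \<bullet> (D *v u)"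
    by (simp add: power2_norm_eq_inner inner_add_left inner_add_right inner_commute)
  moreover have "z \<bullet> (P *v (A *v z + B *v u)) = z \<bullet> (P *v (A *v z)) + z \<bullet> (P *v (B *v u))"
    by (simp add: matrix_vector_right_distrib inner_add_right)
  ultimately show ?thesis using PA by linarith
qed

section \<open>The augmented matrices acting on augmented states and inputs\<close>

lemma A_aug_mult:
  fixes x y :: "real^'n"
  shows "A_aug A a i j *v aug x y = (A i *v x + a i) <@> (A j *v y + a j) <@> 0"
proof -
  have "columnvector b *v (vec 1 :: real^1) = b" for b :: "real^'n"
    by (simp add: vec_eq_iff matrix_vector_mult_def columnvector_def)
  then show ?thesis
    by (simp add: A_aug_def aug_def above_mult_vec beside_mult_vec)
qed

lemma B_aug_mult: "B_aug B *v (u <@> w) = (B *v u) <@> (B *v w) <@> 0"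
  by (simp add: B_aug_def above_mult_vec beside_mult_vec)

lemma C_aug_mult: "C_aug C c i j *v aug x y = (C i *v x + vec (c i)) - (C j *v y + vec (c j))"
  by (simp add: C_aug_def aug_def beside_mult_vec mat_mult_vec uminus_mult_vec vec_eq_iff)

lemma D_aug_mult: "D_aug D *v (u <@> w) = D *\<^sub>R (u - w)"
  by (simp add: D_aug_def beside_mult_vec mat_mult_vec scaleR_diff_right)

lemma I1_aug_quadratic_form: "(vec p <@> vec q) \<bullet> (I1_aug *v (vec p <@> vec q)) = (p - q)\<^sup>2"
  by (simp add: I1_aug_def above_mult_vec beside_mult_vec mat_mult_vec inner_vec_append)
    (simp add: inner_vec_def power2_eq_square algebra_simps)

lemma J_aug_quadratic_form:
  fixes x y :: "real^'n"
  shows "aug x y \<bullet> (J_aug *v aug x y) = (norm (x - y))\<^sup>2"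
proof -
  have "J_aug *v aug x y = P_diag (mat 1) *v aug x y"
    unfolding J_aug_def P_diag_def ..
  then show ?thesis
    by (simp only: P_diag_quadratic_form matrix_vector_mul_lid power2_norm_eq_inner)
qed

lemma P_diag_bilinear_form:
  "aug x y \<bullet> (P_diag P *v (x' <@> y' <@> 0)) = (x - y) \<bullet> (P *v (x' - y'))"
  by (simp add: P_diag_def aug_def above_mult_vec beside_mult_vec inner_vec_append uminus_mult_vec
      matrix_vector_mult_diff_distrib inner_diff_left inner_diff_right)

lemma transpose_P_diag:
  assumes "transpose P = P"
  shows "transpose (P_diag P) = P_diag P"
proof -
  have "P $ r $ s = P $ s $ r" for r s using assms by (simp add: vec_eq_iff transpose_def)
  then show ?thesis
    by (simp add: vec_eq_iff P_diag_def transpose_def above_def beside_def split: sum.split)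
qed

lemma G_aug_inner_nonneg:
  assumes "x \<in> region X m G g i" "y \<in> region X m G g j" "r < m i + m j"
  shows "0 \<le> G_aug m G g i j r \<bullet> aug x y"
proof -
  have "aug x y \<in> aug_region X m G g i j" using assms(1,2) unfolding aug_region_def by blast
  then show ?thesis using assms(3) unfolding aug_region_eq by blast
qed

section \<open>Dissipation and incremental stability\<close>

text \<open>The squared Lipschitz bound, arranged as the incremental quadratic constraint that
  cancels the output term against the input term weighted by \<open>1 / L^2\<close>.\<close>

lemma lipschitz_quotient_power2_le:
  fixes f :: "real \<Rightarrow> real"
  assumes "L-lipschitz_on UNIV f" "0 < L"
  shows "(1 / L\<^sup>2) * (f x - f y)\<^sup>2 \<le> (x - y)\<^sup>2"
proof -
  have "\<bar>f x - f y\<bar> \<le> L * \<bar>x - y\<bar>"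
    using lipschitz_onD[OF assms(1)] by (simp add: dist_real_def)
  then have "\<bar>f x - f y\<bar>\<^sup>2 \<le> (L * \<bar>x - y\<bar>)\<^sup>2" by (rule power_mono) simp
  then show ?thesis using assms(2) by (simp add: power_mult_distrib field_simps)
qed

text \<open>Within one region the affine terms \<open>a\<close> and \<open>c\<close> cancel in
  differences, so the matrix inequality is applied to the linear system with state
  \<open>x - y\<close> and input \<open>p - p'\<close>. The output term is then absorbed by the
  Lipschitz bound.\<close>

lemma dissipation_same_region:
  fixes A P :: "real^'n^'n" and B :: "real^1^'n" and C :: "real^'n^1"
  assumes lmi: "neg_semidef
          (transpose A ** P + P ** A + transpose C ** C + \<sigma> *\<^sub>R mat 1
             <|> P ** B + transpose C ** mat D </>
           transpose (P ** B + transpose C ** mat D)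
             <|> transpose (mat D) ** mat D - mat (1 / \<eta>\<^sup>2))"
    and P: "transpose P = P" and \<epsilon>: "\<eta>-lipschitz_on UNIV \<epsilon>" "0 < \<eta>"
    and x: "q = (C *v x) $ 1 + c + D * p" "p = - \<epsilon> q"
    and y: "q' = (C *v y) $ 1 + c + D * p'" "p' = - \<epsilon> q'"
  shows "2 * (aug x y \<bullet> (P_diag P *v
      ((A *v x + a + B *v vec p) <@> (A *v y + a + B *v vec p') <@> 0))) \<le> - \<sigma> * (norm (x - y))\<^sup>2"
proof -
  have "C *v (x - y) + mat D *v vec (p - p') = vec (q - q')"
    by (simp add: vec_eq_iff mat_mult_vec matrix_vector_mult_diff_distrib x(1) y(1) algebra_simps)
  moreover have "B *v vec (p - p') = B *v vec p - B *v vec p'"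
    by (simp add: vec_eq_iff matrix_vector_mult_def algebra_simps sum_subtractf)
  moreover have "(norm (vec (q - q') :: real^1))\<^sup>2 = (q - q')\<^sup>2"
    unfolding power2_norm_eq_inner by (simp add: inner_vec_def power2_eq_square)
  moreover have "vec (p - p') \<bullet> (mat (1 / \<eta>\<^sup>2) *v (vec (p - p') :: real^1)) = (1 / \<eta>\<^sup>2) * (\<epsilon> q - \<epsilon> q')\<^sup>2"
    unfolding x(2) y(2) mat_mult_vec inner_scaleR_right
    by (simp add: inner_vec_def power2_eq_square algebra_simps)
  moreover have "(1 / \<eta>\<^sup>2) * (\<epsilon> q - \<epsilon> q')\<^sup>2 \<le> (q - q')\<^sup>2"
    by (rule lipschitz_quotient_power2_le[OF \<epsilon>])
  moreover have "(x - y) \<bullet> ((\<sigma> *\<^sub>R mat 1) *v (x - y)) = \<sigma> * (norm (x - y))\<^sup>2"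
    by (simp add: scaleR_mult_vec power2_norm_eq_inner)
  ultimately have "2 * ((x - y) \<bullet> (P *v (A *v (x - y) + (B *v vec p - B *v vec p'))))
      \<le> - \<sigma> * (norm (x - y))\<^sup>2"
    using lmi_dissipation[OF lmi P, of "x - y" "vec (p - p')"] by simp
  moreover have "(A *v x + a + B *v vec p) - (A *v y + a + B *v vec p')
      = A *v (x - y) + (B *v vec p - B *v vec p')"
    by (simp add: matrix_vector_mult_diff_distrib)
  ultimately show ?thesis
    unfolding P_diag_bilinear_form by (simp only:)
qed

text \<open>Different dynamics and affine terms do not cancel, so the augmented state is used with
  the pair of inputs. The augmented output is still \<open>q - q'\<close>, so the Lipschitz bound
  enters as before.\<close>

lemma dissipation_distinct_regions:
  fixes A :: "nat \<Rightarrow> real^'n^'n" and B :: "real^1^'n" and C :: "nat \<Rightarrow> real^'n^1"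
    and Q :: "real^('n + 'n + 1)^('n + 'n + 1)"
  assumes lmi: "neg_semidef
          (transpose (A_aug A a i j) ** Q + Q ** A_aug A a i j
               + transpose (C_aug C c i j) ** C_aug C c i j + \<sigma> *\<^sub>R J_aug
               + congruence (m i + m j) (G_aug m G g i j) W
             <|> Q ** B_aug B + transpose (C_aug C c i j) ** D_aug D </>
           transpose (Q ** B_aug B + transpose (C_aug C c i j) ** D_aug D)
             <|> transpose (D_aug D) ** D_aug D - (1 / \<eta>\<^sup>2) *\<^sub>R I1_aug)"
    and Q: "transpose Q = Q" and W: "sym_nonneg_zero_diag (m i + m j) W"
    and \<epsilon>: "\<eta>-lipschitz_on UNIV \<epsilon>" "0 < \<eta>"
    and x: "x \<in> region X m G g i" "q = (C i *v x) $ 1 + c i + D * p" "p = - \<epsilon> q"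
    and y: "y \<in> region X m G g j" "q' = (C j *v y) $ 1 + c j + D * p'" "p' = - \<epsilon> q'"
  shows "2 * (aug x y \<bullet> (Q *v
      ((A i *v x + a i + B *v vec p) <@> (A j *v y + a j + B *v vec p') <@> 0))) \<le> - \<sigma> * (norm (x - y))\<^sup>2"
proof -
  define u where "u = (vec p <@> vec p' :: real^(1 + 1))"
  have "C_aug C c i j *v aug x y + D_aug D *v u = vec (q - q')"
    by (simp add: u_def C_aug_mult D_aug_mult vec_eq_iff x(2) y(2) algebra_simps)
  moreover have "(norm (vec (q - q') :: real^1))\<^sup>2 = (q - q')\<^sup>2"
    unfolding power2_norm_eq_inner by (simp add: inner_vec_def power2_eq_square)
  moreover have "u \<bullet> (((1 / \<eta>\<^sup>2) *\<^sub>R I1_aug) *v u) = (1 / \<eta>\<^sup>2) * (\<epsilon> q - \<epsilon> q')\<^sup>2"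
    unfolding u_def x(3) y(3) scaleR_mult_vec inner_scaleR_right I1_aug_quadratic_form
    by (simp add: power2_eq_square algebra_simps)
  moreover have "(1 / \<eta>\<^sup>2) * (\<epsilon> q - \<epsilon> q')\<^sup>2 \<le> (q - q')\<^sup>2"
    by (rule lipschitz_quotient_power2_le[OF \<epsilon>])
  moreover have "aug x y \<bullet> ((\<sigma> *\<^sub>R J_aug + congruence (m i + m j) (G_aug m G g i j) W) *v aug x y)
      \<ge> \<sigma> * (norm (x - y))\<^sup>2"
    using congruence_quadratic_form_nonneg[OF W G_aug_inner_nonneg[OF x(1) y(1)]]
    by (simp add: matrix_vector_mult_add_rdistrib inner_add_right scaleR_mult_vec J_aug_quadratic_form)
  moreover have "A_aug A a i j *v aug x y + B_aug B *v u
      = (A i *v x + a i + B *v vec p) <@> (A j *v y + a j + B *v vec p') <@> 0"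
    by (simp add: u_def A_aug_mult B_aug_mult vec_append_add)
  \<comment> \<open>The term in \<open>J_aug\<close> and the congruence term are bracketed together
    to match the single summand \<open>S\<close> of \<open>lmi_dissipation\<close>.\<close>
  ultimately show ?thesis
    using lmi_dissipation[OF lmi[unfolded add.assoc[of _ "\<sigma> *\<^sub>R J_aug"]] Q, of "aug x y" u]
    by simp
qed

lemma region_mem_partition:
  assumes "polyhedral_partition X N m G g" "x \<in> X"
  obtains i where "i \<in> {1..N}" "x \<in> region X m G g i"
  using assms unfolding polyhedral_partition_def by blast

lemma trajectory_ae:
  assumes "is_trajectory X N m G g A a B C c D \<epsilon> x0 x"
  obtains Z where "negligible Z" "\<And>t. \<lbrakk>0 \<le> t; t \<notin> Z\<rbrakk> \<Longrightarrow> \<exists>i\<in>{1..N}. x t \<in> region X m G g i \<and>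
        (\<exists>p q. (x has_vector_derivative (A i *v x t + a i + B *v vec p)) (at t within {0..}) \<and>
          q = (C i *v x t) $ 1 + c i + D * p \<and> p = - \<epsilon> q)"
proof -
  have "AE t in lebesgue. 0 \<le> t \<longrightarrow>
      (\<exists>i\<in>{1..N}. x t \<in> region X m G g i \<and>
        (\<exists>p q. (x has_vector_derivative (A i *v x t + a i + B *v vec p)) (at t within {0..}) \<and>
          q = (C i *v x t) $ 1 + c i + D * p \<and>
          p = - \<epsilon> q))"
    using assms unfolding is_trajectory_def by blast
  then obtain Z where "Z \<in> null_sets lebesgue" "\<And>t. t \<in> space lebesgue - Z \<Longrightarrow> 0 \<le> t \<longrightarrow>
      (\<exists>i\<in>{1..N}. x t \<in> region X m G g i \<and>
        (\<exists>p q. (x has_vector_derivative (A i *v x t + a i + B *v vec p)) (at t within {0..}) \<and>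
          q = (C i *v x t) $ 1 + c i + D * p \<and>
          p = - \<epsilon> q))"
    by (rule AE_E3) blast
  then show thesis by (intro that[of Z]) (auto simp: negligible_iff_null_sets)
qed

lemma class_KL_exponential:
  assumes "0 < k" "0 < \<mu>"
  shows "class_KL (\<lambda>s t. k * s * exp (- \<mu> * t))"
  unfolding class_KL_def
proof (intro conjI allI impI)
  show "continuous_on ({0..} \<times> {0..}) (\<lambda>(s, t). k * s * exp (- \<mu> * t))"
    by (auto simp: case_prod_unfold intro!: continuous_intros)
  fix t :: real
  show "continuous_on {0..} (\<lambda>s. k * s * exp (- \<mu> * t))" by (intro continuous_intros)
  show "strict_mono_on {0..} (\<lambda>s. k * s * exp (- \<mu> * t))"
    using assms by (auto intro!: strict_mono_onI)
next
  fix s :: real assume s: "0 \<le> s"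
  show "antimono_on {0..} (\<lambda>t. k * s * exp (- \<mu> * t))"
    using assms s by (auto intro!: monotone_onI mult_left_mono)
  have "((\<lambda>t. exp (- \<mu> * t)) \<longlongrightarrow> 0) at_top"
    using assms(2) by (intro filterlim_compose[OF exp_at_bot] filterlim_tendsto_neg_mult_at_bot[OF tendsto_const])
      (auto intro: filterlim_ident)
  from tendsto_mult_right_zero[OF this, of "k * s"]
  show "((\<lambda>t. k * s * exp (- \<mu> * t)) \<longlongrightarrow> 0) at_top" .
qed (use assms in auto)

theorem theorem4p1:
  fixes X :: "(real^'n) set" and N :: nat
    and m :: "nat \<Rightarrow> nat"
    and G :: "nat \<Rightarrow> nat \<Rightarrow> real^'n"
    and g :: "nat \<Rightarrow> nat \<Rightarrow> real"
    and A :: "nat \<Rightarrow> real^'n^'n"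
    and a :: "nat \<Rightarrow> real^'n"
    and B :: "real^1^'n"
    and C :: "nat \<Rightarrow> real^'n^1"
    and c :: "nat \<Rightarrow> real"
    and D :: real
    and \<epsilon> :: "real \<Rightarrow> real" and \<eta> :: real
    and \<phi> :: "real \<Rightarrow> real \<Rightarrow> real^'n \<Rightarrow> real^'n"
    and E :: "nat \<Rightarrow> nat \<Rightarrow> nat \<Rightarrow> nat \<Rightarrow> real^('n + 'n + 1)^1"
    and P :: "nat \<Rightarrow> real^'n^'n"
    and Q :: "nat \<Rightarrow> nat \<Rightarrow> real^('n + 'n + 1)^('n + 'n + 1)"
    and U R W :: "nat \<Rightarrow> nat \<Rightarrow> nat \<Rightarrow> nat \<Rightarrow> real"
    and L :: "nat \<Rightarrow> nat \<Rightarrow> nat \<Rightarrow> nat \<Rightarrow> real^1^('n + 'n + 1)"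
    and \<sigma>1 \<sigma>2 \<sigma>3 :: real
  assumes "polyhedral_partition X N m G g"
    and "0 < \<eta>" and "\<eta>-lipschitz_on UNIV \<epsilon>"
    and "is_state_transition_map X N m G g A a B C c D \<epsilon> \<phi>"
    and "\<And>i j k l. \<lbrakk>i \<in> {1..N}; j \<in> {1..N}; k \<in> {1..N}; l \<in> {1..N}; (i, j) \<noteq> (k, l);
          aug_region X m G g i j \<inter> aug_region X m G g k l \<noteq> {}\<rbrakk> \<Longrightarrow>
        aug_region X m G g i j \<inter> aug_region X m G g k l \<subseteq>
          {z \<in> {aug x y | x y. x \<in> X \<and> y \<in> X}. E i j k l *v z = 0}"
    and "\<And>i. i \<in> {1..N} \<Longrightarrow> transpose (P i) = P i"
    and "\<And>i j. \<lbrakk>i \<in> {1..N}; j \<in> {1..N}; i \<noteq> j\<rbrakk> \<Longrightarrow> transpose (Q i j) = Q i j"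
    and "\<And>i j. \<lbrakk>i \<in> {1..N}; j \<in> {1..N}; i \<noteq> j\<rbrakk> \<Longrightarrow>
        sym_nonneg_zero_diag (m i + m j) (U i j) \<and>
        sym_nonneg_zero_diag (m i + m j) (R i j) \<and>
        sym_nonneg_zero_diag (m i + m j) (W i j)"
    and "0 < \<sigma>1" and "0 < \<sigma>2" and "0 < \<sigma>3"
    and "\<And>i. i \<in> {1..N} \<Longrightarrow>
        pos_semidef (P i - \<sigma>1 *\<^sub>R mat 1) \<and>
        neg_semidef (P i - \<sigma>2 *\<^sub>R mat 1) \<and>
        neg_semidef
          (transpose (A i) ** P i + P i ** A i + transpose (C i) ** C i + \<sigma>3 *\<^sub>R mat 1
             <|> P i ** B + transpose (C i) ** mat D </>
           transpose (P i ** B + transpose (C i) ** mat D)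
             <|> transpose (mat D) ** mat D - mat (1 / \<eta>\<^sup>2))"
    and "\<And>i j. \<lbrakk>i \<in> {1..N}; j \<in> {1..N}; i \<noteq> j\<rbrakk> \<Longrightarrow>
        pos_semidef (Q i j - \<sigma>1 *\<^sub>R J_aug - congruence (m i + m j) (G_aug m G g i j) (U i j)) \<and>
        neg_semidef (Q i j - \<sigma>2 *\<^sub>R J_aug + congruence (m i + m j) (G_aug m G g i j) (R i j)) \<and>
        neg_semidef
          (transpose (A_aug A a i j) ** Q i j + Q i j ** A_aug A a i j
               + transpose (C_aug C c i j) ** C_aug C c i j + \<sigma>3 *\<^sub>R J_aug
               + congruence (m i + m j) (G_aug m G g i j) (W i j)
             <|> Q i j ** B_aug B + transpose (C_aug C c i j) ** D_aug D </>
           transpose (Q i j ** B_aug B + transpose (C_aug C c i j) ** D_aug D)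
             <|> transpose (D_aug D) ** D_aug D - (1 / \<eta>\<^sup>2) *\<^sub>R I1_aug)"
    and "\<And>i j k l. \<lbrakk>i \<in> {1..N}; j \<in> {1..N}; k \<in> {1..N}; l \<in> {1..N}; (i, j) \<noteq> (k, l);
          aug_region X m G g i j \<inter> aug_region X m G g k l \<noteq> {}\<rbrakk> \<Longrightarrow>
        P_aug P Q i j = P_aug P Q k l + L i j k l ** E i j k l + transpose (E i j k l) ** transpose (L i j k l)"
  shows "incrementally_asymptotically_stable X \<phi>"
proof -
  note part = assms(1) and \<eta> = assms(2) and lip = assms(3) and stm = assms(4)
    and surf = assms(5) and symP = assms(6) and symQ = assms(7) and nonneg = assms(8)
    and pos = assms(9-11) and diag = assms(12) and offdiag = assms(13) and glue = assms(14)

  \<comment> \<open>Bounds and consistency of the piecewise quadratic function\<close>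
  define V where "V i j z = z \<bullet> (P_aug P Q i j *v z)" for i j z
  have sym: "transpose (P_aug P Q i j) = P_aug P Q i j" if "i \<in> {1..N}" "j \<in> {1..N}" for i j
    using that symP symQ by (auto simp: P_aug_def transpose_P_diag)
  \<comment> \<open>On the diagonal the test vector is \<open>x - y\<close>; off the diagonal it is
    \<open>aug x y\<close>, where the congruence terms in \<open>U\<close> and \<open>R\<close> have
    the favourable sign.\<close>
  have lower: "\<sigma>1 * (norm (x - y))\<^sup>2 \<le> V i j (aug x y)"
    and upper: "V i j (aug x y) \<le> \<sigma>2 * (norm (x - y))\<^sup>2"
    if ij: "i \<in> {1..N}" "j \<in> {1..N}" and xy: "x \<in> region X m G g i" "y \<in> region X m G g j" for i j x y
  proof -
    have "\<sigma>1 * (norm (x - y))\<^sup>2 \<le> V i j (aug x y) \<and> V i j (aug x y) \<le> \<sigma>2 * (norm (x - y))\<^sup>2"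
    proof (cases "i = j")
      case True
      have "0 \<le> (x - y) \<bullet> ((P i - \<sigma>1 *\<^sub>R mat 1) *v (x - y))"
        "(x - y) \<bullet> ((P i - \<sigma>2 *\<^sub>R mat 1) *v (x - y)) \<le> 0"
        using diag[OF ij(1)] unfolding pos_semidef_def neg_semidef_def by blast+
      then show ?thesis
        using True by (simp add: V_def P_aug_def P_diag_quadratic_form matrix_vector_mult_diff_rdistrib
            inner_diff_right scaleR_mult_vec power2_norm_eq_inner)
    next
      case False
      have "0 \<le> aug x y \<bullet> ((Q i j - \<sigma>1 *\<^sub>R J_aug - congruence (m i + m j) (G_aug m G g i j) (U i j)) *v aug x y)"
        "aug x y \<bullet> ((Q i j - \<sigma>2 *\<^sub>R J_aug + congruence (m i + m j) (G_aug m G g i j) (R i j)) *v aug x y) \<le> 0"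
        using offdiag[OF ij False] unfolding pos_semidef_def neg_semidef_def by blast+
      moreover have "0 \<le> aug x y \<bullet> (congruence (m i + m j) (G_aug m G g i j) (U i j) *v aug x y)"
        "0 \<le> aug x y \<bullet> (congruence (m i + m j) (G_aug m G g i j) (R i j) *v aug x y)"
        using nonneg[OF ij False] congruence_quadratic_form_nonneg G_aug_inner_nonneg[OF xy] by blast+
      ultimately show ?thesis
        using False by (simp add: V_def P_aug_def matrix_vector_mult_diff_rdistrib
            matrix_vector_mult_add_rdistrib inner_diff_right inner_add_right scaleR_mult_vec
            J_aug_quadratic_form)
    qed
    then show "\<sigma>1 * (norm (x - y))\<^sup>2 \<le> V i j (aug x y)" "V i j (aug x y) \<le> \<sigma>2 * (norm (x - y))\<^sup>2"
      by auto
  qed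
  \<comment> \<open>The two correction terms in \<open>P_aug\<close> are transposes of each other
    and each contains the factor \<open>E i j k l *v aug x y\<close>, which vanishes on the
    overlap.\<close>
  have consistent: "V i j (aug x y) = V k l (aug x y)"
    if "i \<in> {1..N}" "j \<in> {1..N}" "k \<in> {1..N}" "l \<in> {1..N}"
      and x: "x \<in> region X m G g i" "x \<in> region X m G g k"
      and y: "y \<in> region X m G g j" "y \<in> region X m G g l" for i j k l x y
  proof (cases "(i, j) = (k, l)")
    case False
    have z: "aug x y \<in> aug_region X m G g i j \<inter> aug_region X m G g k l"
      using x y unfolding aug_region_def by blast
    then have "E i j k l *v aug x y = 0" using surf[OF that(1-4) False] by blast
    moreover have "P_aug P Q i j = P_aug P Q k l + L i j k l ** E i j k l
        + transpose (E i j k l) ** transpose (L i j k l)"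
      using z glue[OF that(1-4) False] by blast
    ultimately show ?thesis
      by (simp add: V_def matrix_vector_mult_add_rdistrib inner_add_right inner_transpose_mult
          del: transpose_matrix_vector flip: matrix_vector_mul_assoc)
  qed simp

  \<comment> \<open>Exponential decay along a pair of trajectories\<close>
  define \<mu> where "\<mu> = \<sigma>3 / \<sigma>2"
  have \<mu>: "0 < \<mu>" using pos by (simp add: \<mu>_def)
  have main: "norm (\<phi> T 0 x0 - \<phi> T 0 y0) \<le> sqrt (\<sigma>2 / \<sigma>1) * norm (x0 - y0) * exp (- (\<mu> / 2) * T)"
    if x0: "x0 \<in> X" and y0: "y0 \<in> X" and T: "0 \<le> T" for x0 y0 T
  proof -
    define x y where "x t = \<phi> t 0 x0" and "y t = \<phi> t 0 y0" for t
    have tr_x: "is_trajectory X N m G g A a B C c D \<epsilon> x0 x"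
      and tr_y: "is_trajectory X N m G g A a B C c D \<epsilon> y0 y"
      using stm x0 y0 unfolding is_state_transition_map_def x_def y_def by auto
    have inX: "x t \<in> X" "y t \<in> X" if "0 \<le> t" for t
      using tr_x tr_y that unfolding is_trajectory_def by auto
    have acx: "abs_continuous_on_interval 0 T x" and acy: "abs_continuous_on_interval 0 T y"
      using tr_x tr_y T unfolding is_trajectory_def by auto
    obtain Zx where Zx: "negligible Zx" "\<And>t. \<lbrakk>0 \<le> t; t \<notin> Zx\<rbrakk> \<Longrightarrow> \<exists>i\<in>{1..N}. x t \<in> region X m G g i \<and>
        (\<exists>p q. (x has_vector_derivative (A i *v x t + a i + B *v vec p)) (at t within {0..}) \<and>
          q = (C i *v x t) $ 1 + c i + D * p \<and> p = - \<epsilon> q)"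
      using trajectory_ae[OF tr_x] by blast
    obtain Zy where Zy: "negligible Zy" "\<And>t. \<lbrakk>0 \<le> t; t \<notin> Zy\<rbrakk> \<Longrightarrow> \<exists>i\<in>{1..N}. y t \<in> region X m G g i \<and>
        (\<exists>p q. (y has_vector_derivative (A i *v y t + a i + B *v vec p)) (at t within {0..}) \<and>
          q = (C i *v y t) $ 1 + c i + D * p \<and> p = - \<epsilon> q)"
      using trajectory_ae[OF tr_y] by blast
    define K where "K = {1..N} \<times> {1..N}"
    \<comment> \<open>The times at which the pair occupies the regions indexed by \<open>k\<close>;
      they form a closed set by continuity of the trajectories.\<close>
    define S where "S k = {t \<in> {0..T}. x t \<in> region X m G g (fst k) \<and> y t \<in> region X m G g (snd k)}" for k
    define F where "F k t = V (fst k) (snd k) (aug (x t) (y t))" for k t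
    \<comment> \<open>Any occupied pair of regions may be selected: by \<open>consistent\<close> the
      value does not depend on the choice.\<close>
    define v where "v t = F (SOME k. k \<in> K \<and> t \<in> S k) t" for t
    have finK: "finite K" by (simp add: K_def)
    have clS: "closed (S k)" if "k \<in> K" for k
    proof -
      have "closed (region X m G g i)" if "i \<in> {1..N}" for i
        using part that unfolding polyhedral_partition_def by (blast intro: polyhedron_imp_closed)
      then have "closed ({0..T} \<inter> x -` region X m G g (fst k))" "closed ({0..T} \<inter> y -` region X m G g (snd k))"
        using that abs_continuous_imp_continuous_on[OF acx] abs_continuous_imp_continuous_on[OF acy]
        by (auto simp: K_def intro!: continuous_closed_preimage)
      moreover have "S k = ({0..T} \<inter> x -` region X m G g (fst k)) \<inter> ({0..T} \<inter> y -` region X m G g (snd k))"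
        by (auto simp: S_def)
      ultimately show ?thesis by (simp add: closed_Int)
    qed
    have ex: "\<exists>k\<in>K. t \<in> S k" if t: "t \<in> {0..T}" for t
    proof -
      obtain i where "i \<in> {1..N}" "x t \<in> region X m G g i"
        using region_mem_partition[OF part inX(1)] t by auto
      moreover obtain j where "j \<in> {1..N}" "y t \<in> region X m G g j"
        using region_mem_partition[OF part inX(2)] t by auto
      ultimately show ?thesis using t by (intro bexI[of _ "(i, j)"]) (auto simp: K_def S_def)
    qed
    have covS: "(\<Union>k\<in>K. S k) = {0..T}"
      using ex by (auto simp: S_def)
    have vF: "v t = F k t" if k: "k \<in> K" "t \<in> S k" for k t
    proof -
      have "(SOME k. k \<in> K \<and> t \<in> S k) \<in> K \<and> t \<in> S (SOME k. k \<in> K \<and> t \<in> S k)"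
        by (rule someI[of _ k]) (use k in blast)
      then show ?thesis
        using k unfolding v_def F_def by (intro consistent) (auto simp: K_def S_def)
    qed
    have acF: "abs_continuous_on_interval 0 T (F k)" for k
    proof -
      have acz: "abs_continuous_on_interval 0 T (\<lambda>t. aug (x t) (y t))"
      proof (rule abs_continuous_dominated[OF acx acy, where K = 1])
        fix s t
        have "norm (aug (x t) (y t) - aug (x s) (y s)) \<le> norm (x t - x s) + (norm (y t - y s) + norm (0 :: real^1))"
          unfolding aug_def vec_append_diff diff_self
          by (meson add_left_mono norm_vec_append_le order_trans)
        then show "norm (aug (x t) (y t) - aug (x s) (y s)) \<le> 1 * (norm (x t - x s) + norm (y t - y s))"
          by simp
      qed
      have "bounded_bilinear (\<lambda>z w. z \<bullet> (P_aug P Q (fst k) (snd k) *v w))"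
        by (rule bounded_bilinear.comp[OF bounded_bilinear_inner bounded_linear_ident matrix_vector_mul_bounded_linear])
      from abs_continuous_bilinear[OF this acz acz] show ?thesis by (simp add: F_def[abs_def] V_def)
    qed
    have derF: "(F k has_real_derivative 2 * (aug (x t) (y t) \<bullet> (P_aug P Q (fst k) (snd k) *v (x' <@> y' <@> 0))))
        (at t within {0..T})"
      if "k \<in> K" "(x has_vector_derivative x') (at t within {0..})" "(y has_vector_derivative y') (at t within {0..})"
      for k t x' y'
    proof -
      have "(x has_vector_derivative x') (at t within {0..T})" "(y has_vector_derivative y') (at t within {0..T})"
        using that(2,3) by (auto intro: has_vector_derivative_within_subset)
      from has_real_derivative_quadratic_form[OF has_vector_derivative_aug[OF this] sym]
      show ?thesis using that(1) by (auto simp: F_def[abs_def] V_def K_def)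
    qed
    have "v T \<le> exp (- \<mu> * (T - 0)) * v 0"
    proof (rule piecewise_exponential_decay[OF T finK clS covS vF acF])
      show "negligible (Zx \<union> Zy)" using Zx(1) Zy(1) by simp
    next
      fix k t assume k: "k \<in> K" and t: "t \<in> {0..T}" "t \<notin> Zx \<union> Zy"
      obtain x' where "(x has_vector_derivative x') (at t within {0..})"
        using Zx(2)[of t] t by auto
      moreover obtain y' where "(y has_vector_derivative y') (at t within {0..})"
        using Zy(2)[of t] t by auto
      ultimately show "\<exists>d. (F k has_real_derivative d) (at t within {0..T})"
        using derF[OF k] by blast
    next
      fix t assume t: "t \<in> {0..T}" "t \<notin> Zx \<union> Zy"
      then have t0: "0 \<le> t" "t \<notin> Zx" "t \<notin> Zy" by auto
      \<comment> \<open>The regions taken here are those whose vector fields are active at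
        \<open>t\<close>; they need not be the pair selected in \<open>v\<close>.\<close>
      obtain i p q where i: "i \<in> {1..N}" "x t \<in> region X m G g i"
        "(x has_vector_derivative (A i *v x t + a i + B *v vec p)) (at t within {0..})"
        "q = (C i *v x t) $ 1 + c i + D * p" "p = - \<epsilon> q"
        using Zx(2)[OF t0(1,2)] by blast
      obtain j p' q' where j: "j \<in> {1..N}" "y t \<in> region X m G g j"
        "(y has_vector_derivative (A j *v y t + a j + B *v vec p')) (at t within {0..})"
        "q' = (C j *v y t) $ 1 + c j + D * p'" "p' = - \<epsilon> q'"
        using Zy(2)[OF t0(1,3)] by blast
      define d where "d = 2 * (aug (x t) (y t) \<bullet> (P_aug P Q i j *v
        ((A i *v x t + a i + B *v vec p) <@> (A j *v y t + a j + B *v vec p') <@> 0)))"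
      have "d \<le> - \<sigma>3 * (norm (x t - y t))\<^sup>2"
      proof (cases "i = j")
        case True
        show ?thesis
          using dissipation_same_region[OF diag[OF i(1), THEN conjunct2, THEN conjunct2] symP[OF i(1)]
              lip \<eta> i(4,5) j(4,5)[folded True], where a = "a i"]
          by (simp add: d_def P_aug_def flip: True)
      next
        case False
        show ?thesis
          using dissipation_distinct_regions[OF
              offdiag[OF i(1) j(1) False, THEN conjunct2, THEN conjunct2] symQ[OF i(1) j(1) False]
              nonneg[OF i(1) j(1) False, THEN conjunct2, THEN conjunct2] lip \<eta> i(2,4,5) j(2,4,5)] False
          by (simp add: d_def P_aug_def)
      qed
      \<comment> \<open>The rate \<mu> is the quotient of \<sigma>3 by \<sigma>2, so the upper bound
        on \<open>V\<close> turns decay in terms of the distance into decay in terms of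
        \<open>V\<close>.\<close>
      also have "\<dots> = - \<mu> * (\<sigma>2 * (norm (x t - y t))\<^sup>2)" using pos by (simp add: \<mu>_def)
      also have "\<dots> \<le> - \<mu> * V i j (aug (x t) (y t))"
        using upper[OF i(1) j(1) i(2) j(2)] \<mu> by simp
      finally have "d \<le> - \<mu> * F (i, j) t" by (simp add: F_def)
      then show "\<exists>k\<in>K. t \<in> S k \<and> (\<exists>d. d \<le> - \<mu> * F k t \<and> (F k has_real_derivative d) (at t within {0..T}))"
        using i(1,2) j(1,2) t derF[OF _ i(3) j(3), of "(i, j)"]
        by (intro bexI[of _ "(i, j)"]) (auto simp: K_def S_def d_def)
    qed
    moreover have "\<sigma>1 * (norm (x T - y T))\<^sup>2 \<le> v T"
    proof -
      obtain k where k: "k \<in> K" "T \<in> S k" using ex[of T] T by auto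
      then show ?thesis using lower[of "fst k" "snd k" "x T" "y T"] vF[OF k] by (auto simp: F_def K_def S_def)
    qed
    moreover have "v 0 \<le> \<sigma>2 * (norm (x0 - y0))\<^sup>2"
    proof -
      obtain k where k: "k \<in> K" "0 \<in> S k" using ex[of 0] T by auto
      moreover have "x 0 = x0" "y 0 = y0" using tr_x tr_y unfolding is_trajectory_def by auto
      ultimately show ?thesis
        using upper[of "fst k" "snd k" "x 0" "y 0"] vF[OF k] by (auto simp: F_def K_def S_def)
    qed
    ultimately have "\<sigma>1 * (norm (x T - y T))\<^sup>2 \<le> exp (- \<mu> * T) * (\<sigma>2 * (norm (x0 - y0))\<^sup>2)"
      by (smt (verit) exp_gt_zero diff_zero mult_left_mono)
    \<comment> \<open>\<open>V\<close> compares with the squared distance, so the distance itself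
      decays at half the rate.\<close>
    moreover have "exp (- \<mu> * T) = (exp (- (\<mu> / 2) * T))\<^sup>2"
      by (simp add: power2_eq_square flip: exp_add)
    ultimately have "(norm (x T - y T))\<^sup>2 \<le> (sqrt (\<sigma>2 / \<sigma>1) * norm (x0 - y0) * exp (- (\<mu> / 2) * T))\<^sup>2"
      using pos by (simp add: power_mult_distrib field_simps)
    then have "norm (x T - y T) \<le> sqrt (\<sigma>2 / \<sigma>1) * norm (x0 - y0) * exp (- (\<mu> / 2) * T)"
      by (rule power2_le_imp_le) (use pos in simp)
    then show ?thesis by (simp add: x_def y_def)
  qed

  \<comment> \<open>The comparison function of class KL\<close>
  show ?thesis
    unfolding incrementally_asymptotically_stable_def
    using class_KL_exponential[of "sqrt (\<sigma>2 / \<sigma>1)" "\<mu> / 2"] main \<mu> pos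
    by (intro exI[of _ "\<lambda>s t. sqrt (\<sigma>2 / \<sigma>1) * s * exp (- (\<mu> / 2) * t)"]) auto
qed

end
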